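(* Let $\mathcal D$ be a directed acyclic graph with finite vertex set $V$, let $<$ be a topological ordering of $\mathcal D$, and let $\rho\in\mathbb S_1^+(\mathcal H_V)$. Then the following three properties of $\rho$ are equivalent: (O) (ordered Markov property) for every $v\in V$, $v\perp\!\!\!\perp_Q(\operatorname{pr}(v)\setminus\operatorname{pa}(v))\mid\operatorname{pa}(v)$; (L) (local Markov property) for every $v\in V$, $v\perp\!\!\!\perp_Q(\operatorname{nd}(v)\setminus\operatorname{pa}(v))\mid\operatorname{pa}(v)$; (G) (global Markov property) for all pairwise disjoint $A,B,S\subseteq V$, if $A$ and $B$ are $d$-separated by $S$ in $\mathcal D$, then $A\perp\!\!\!\perp_Q B\mid S$. All quantum conditional independences are with respect to $\rho$.
   Context: For each $v\in V$, $\mathcal H_v$ is a finite-dimensional complex Hilbert space; $\mathcal H_A=\bigotimes_{v\in A}\mathcal H_v$ for $A\subseteq V$, with $\mathcal H_\varnothing=\mathbb C$. $\mathbb S_1^+(\mathcal H_A)$ is the set of positive definite (self-adjoint) operators on $\mathcal H_A$ of trace one. For $A\subseteq V$, $\rho_A=\operatorname{Tr}_{V\setminus A}(\rho)$ is the marginal (partial trace over the complement). The von Neumann entropy is $\operatorname S(A)_\rho=-\operatorname{Tr}(\rho_A\log\rho_A)$, with $\operatorname S(\varnothing)_\rho=0$. For pairwise disjoint $A,B,C\subseteq V$, $$I(A:B\mid C)_\rho=\operatorname S(A\cup C)_\rho+\operatorname S(B\cup C)_\rho-\operatorname S(C)_\rho-\operatorname S(A\cup B\cup C)_\rho,$$ and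 $A\perp\!\!\!\perp_Q B\mid C$ means $I(A:B\mid C)_\rho=0$. A vertex $v$ is identified with $\{v\}$. For a vertex $v$ of $\mathcal D$: $\operatorname{pa}(v)$ is its set of parents, $\operatorname{de}(v)$ its set of descendants (excluding $v$), $\operatorname{nd}(v)=V\setminus(\{v\}\cup\operatorname{de}(v))$. A total ordering $<$ of $V$ is topological if $u<w$ for every arrow $u\to w$; $\operatorname{pr}(v)=\{u\in V:u<v\}$. A walk (repeated vertices allowed, arrows traversable in either direction) has a collider at a non-endpoint $\alpha_i$ if $\alpha_{i-1}\to\alpha_i\leftarrow\alpha_{i+1}$. A walk is active relative to $S$ if every non-collider on it is outside $S$ and every collider on it is in $S$; otherwise it is blocked by $S$. Disjoint $A,B$ are $d$-separated by $S$ if every walk from $A$ to $B$ is blocked by $S$. *)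

theory Defs
  imports "HOL-Analysis.Analysis"
begin

text \<open>
  We fix an orthonormal basis of each finite-dimensional Hilbert space \<open>H\<^sub>v\<close>, i.e. take
  \<open>H\<^sub>v = \<complex>\<^bsup>d v\<^esup>\<close>. The product basis of \<open>H\<^sub>A\<close>, the tensor product of the \<open>H\<^sub>v\<close> over
  \<open>v \<in> A\<close>, is then indexed by \<^term>\<open>PiE A (\<lambda>v. {..<d v})\<close>; this is a singleton for \<open>A = {}\<close>,
  so that \<open>H\<close> of the empty set is \<open>\<complex>\<close>. An operator on a space with basis index set \<open>X\<close> is given
  by its matrix \<open>M x y\<close> with \<open>x, y \<in> X\<close>; entries outside \<open>X \<times> X\<close> play no role.
\<close>

type_synonym 'i op = "'i \<Rightarrow> 'i \<Rightarrow> complex"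

definition op_mult :: "'i set \<Rightarrow> 'i op \<Rightarrow> 'i op \<Rightarrow> 'i op" where
  "op_mult X M N = (\<lambda>x y. \<Sum>z\<in>X. M x z * N z y)"

definition op_trace :: "'i set \<Rightarrow> 'i op \<Rightarrow> complex" where
  "op_trace X M = (\<Sum>x\<in>X. M x x)"

definition self_adjoint :: "'i set \<Rightarrow> 'i op \<Rightarrow> bool" where
  "self_adjoint X M \<longleftrightarrow> (\<forall>x\<in>X. \<forall>y\<in>X. M x y = cnj (M y x))"

definition positive_definite :: "'i set \<Rightarrow> 'i op \<Rightarrow> bool" where
  "positive_definite X M \<longleftrightarrow> self_adjoint X M \<and>
     (\<forall>u::'i \<Rightarrow> complex. (\<exists>x\<in>X. u x \<noteq> 0) \<longrightarrow>
        Re (\<Sum>x\<in>X. \<Sum>y\<in>X. cnj (u x) * M x y * u y) > 0)"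

text \<open>
  An orthonormal family indexed by \<open>X\<close> itself has as many members as the dimension and is
  therefore a basis; \<open>e k x\<close> is the \<open>x\<close>-coordinate of its \<open>k\<close>-th member.
\<close>

definition orthonormal_basis :: "'i set \<Rightarrow> ('i \<Rightarrow> 'i \<Rightarrow> complex) \<Rightarrow> bool" where
  "orthonormal_basis X e \<longleftrightarrow>
     (\<forall>j\<in>X. \<forall>k\<in>X. (\<Sum>x\<in>X. cnj (e j x) * e k x) = (if j = k then 1 else 0))"

definition from_spectrum :: "'i set \<Rightarrow> ('i \<Rightarrow> 'i \<Rightarrow> complex) \<Rightarrow> ('i \<Rightarrow> real) \<Rightarrow> 'i op" where
  "from_spectrum X e l = (\<lambda>x y. \<Sum>k\<in>X. complex_of_real (l k) * e k x * cnj (e k y))"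

text \<open>
  Functional calculus: the logarithm acts as \<open>ln\<close> of the eigenvalue on each vector of an
  orthonormal eigenbasis of \<open>M\<close>. The entries on \<open>X \<times> X\<close> do not depend on the eigenbasis chosen.
  Meaningful for positive definite \<open>M\<close>.
\<close>

definition op_log :: "'i set \<Rightarrow> 'i op \<Rightarrow> 'i op" where
  "op_log X M = (SOME L. \<exists>e l. orthonormal_basis X e \<and>
      (\<forall>x\<in>X. \<forall>y\<in>X. M x y = from_spectrum X e l x y) \<and>
      L = from_spectrum X e (\<lambda>k. ln (l k)))"

definition basis_index :: "('v \<Rightarrow> nat) \<Rightarrow> 'v set \<Rightarrow> ('v \<Rightarrow> nat) set" where
  "basis_index d A = PiE A (\<lambda>v. {..<d v})"

definition density_pd :: "('v \<Rightarrow> nat) \<Rightarrow> 'v set \<Rightarrow> ('v \<Rightarrow> nat) op \<Rightarrow> bool" where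
  "density_pd d A \<rho> \<longleftrightarrow>
     positive_definite (basis_index d A) \<rho> \<and> op_trace (basis_index d A) \<rho> = 1"

definition marginal ::
    "('v \<Rightarrow> nat) \<Rightarrow> 'v set \<Rightarrow> ('v \<Rightarrow> nat) op \<Rightarrow> 'v set \<Rightarrow> ('v \<Rightarrow> nat) op" where
  "marginal d V \<rho> A = (\<lambda>x y. \<Sum>z\<in>basis_index d (V - A).
      \<rho> (merge A (V - A) (x, z)) (merge A (V - A) (y, z)))"

definition vn_entropy ::
    "('v \<Rightarrow> nat) \<Rightarrow> 'v set \<Rightarrow> ('v \<Rightarrow> nat) op \<Rightarrow> 'v set \<Rightarrow> real" where
  "vn_entropy d V \<rho> A =
     (let X = basis_index d A; R = marginal d V \<rho> A
      in - Re (op_trace X (op_mult X R (op_log X R))))"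

definition cond_mutual_info ::
    "('v \<Rightarrow> nat) \<Rightarrow> 'v set \<Rightarrow> ('v \<Rightarrow> nat) op \<Rightarrow> 'v set \<Rightarrow> 'v set \<Rightarrow> 'v set \<Rightarrow> real" where
  "cond_mutual_info d V \<rho> A B C =
     vn_entropy d V \<rho> (A \<union> C) + vn_entropy d V \<rho> (B \<union> C)
     - vn_entropy d V \<rho> C - vn_entropy d V \<rho> (A \<union> B \<union> C)"

definition q_cond_indep ::
    "('v \<Rightarrow> nat) \<Rightarrow> 'v set \<Rightarrow> ('v \<Rightarrow> nat) op \<Rightarrow> 'v set \<Rightarrow> 'v set \<Rightarrow> 'v set \<Rightarrow> bool" where
  "q_cond_indep d V \<rho> A B C \<longleftrightarrow> cond_mutual_info d V \<rho> A B C = 0"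

text \<open>Directed graphs: \<open>(u, w) \<in> E\<close> is the arrow from \<open>u\<close> to \<open>w\<close>.\<close>

definition dag :: "'v set \<Rightarrow> ('v \<times> 'v) set \<Rightarrow> bool" where
  "dag V E \<longleftrightarrow> E \<subseteq> V \<times> V \<and> acyclic E"

definition parents :: "('v \<times> 'v) set \<Rightarrow> 'v \<Rightarrow> 'v set" where
  "parents E v = {u. (u, v) \<in> E}"

definition descendants :: "('v \<times> 'v) set \<Rightarrow> 'v \<Rightarrow> 'v set" where
  "descendants E v = {w. (v, w) \<in> E\<^sup>+} - {v}"

definition nondescendants :: "'v set \<Rightarrow> ('v \<times> 'v) set \<Rightarrow> 'v \<Rightarrow> 'v set" where
  "nondescendants V E v = V - ({v} \<union> descendants E v)"

definition topological_ordering :: "'v set \<Rightarrow> ('v \<times> 'v) set \<Rightarrow> ('v \<times> 'v) set \<Rightarrow> bool" where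
  "topological_ordering V E r \<longleftrightarrow> r \<subseteq> V \<times> V \<and> strict_linear_order_on V r \<and> E \<subseteq> r"

definition predecessors :: "'v set \<Rightarrow> ('v \<times> 'v) set \<Rightarrow> 'v \<Rightarrow> 'v set" where
  "predecessors V r v = {u \<in> V. (u, v) \<in> r}"

text \<open>
  In an acyclic graph two vertices are joined by at most one arrow, so a walk is determined by
  its list of vertices.
\<close>

definition walk :: "'v set \<Rightarrow> ('v \<times> 'v) set \<Rightarrow> 'v list \<Rightarrow> bool" where
  "walk V E p \<longleftrightarrow> p \<noteq> [] \<and> set p \<subseteq> V \<and>
     successively (\<lambda>u w. (u, w) \<in> E \<or> (w, u) \<in> E) p"

definition collider :: "('v \<times> 'v) set \<Rightarrow> 'v list \<Rightarrow> nat \<Rightarrow> bool" where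
  "collider E p i \<longleftrightarrow> 0 < i \<and> Suc i < length p \<and>
     (p ! (i - 1), p ! i) \<in> E \<and> (p ! Suc i, p ! i) \<in> E"

definition active :: "('v \<times> 'v) set \<Rightarrow> 'v set \<Rightarrow> 'v list \<Rightarrow> bool" where
  "active E S p \<longleftrightarrow> (\<forall>i < length p. collider E p i \<longleftrightarrow> p ! i \<in> S)"

definition d_separated ::
    "'v set \<Rightarrow> ('v \<times> 'v) set \<Rightarrow> 'v set \<Rightarrow> 'v set \<Rightarrow> 'v set \<Rightarrow> bool" where
  "d_separated V E A B S \<longleftrightarrow>
     (\<forall>p. walk V E p \<and> hd p \<in> A \<and> last p \<in> B \<longrightarrow> \<not> active E S p)"

definition ordered_markov ::
    "('v \<Rightarrow> nat) \<Rightarrow> 'v set \<Rightarrow> ('v \<times> 'v) set \<Rightarrow> ('v \<times> 'v) set \<Rightarrow> ('v \<Rightarrow> nat) op \<Rightarrow> bool" where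
  "ordered_markov d V E r \<rho> \<longleftrightarrow>
     (\<forall>v\<in>V. q_cond_indep d V \<rho> {v} (predecessors V r v - parents E v) (parents E v))"

definition local_markov ::
    "('v \<Rightarrow> nat) \<Rightarrow> 'v set \<Rightarrow> ('v \<times> 'v) set \<Rightarrow> ('v \<Rightarrow> nat) op \<Rightarrow> bool" where
  "local_markov d V E \<rho> \<longleftrightarrow>
     (\<forall>v\<in>V. q_cond_indep d V \<rho> {v} (nondescendants V E v - parents E v) (parents E v))"

definition global_markov ::
    "('v \<Rightarrow> nat) \<Rightarrow> 'v set \<Rightarrow> ('v \<times> 'v) set \<Rightarrow> ('v \<Rightarrow> nat) op \<Rightarrow> bool" where
  "global_markov d V E \<rho> \<longleftrightarrow>
     (\<forall>A B S. A \<subseteq> V \<and> B \<subseteq> V \<and> S \<subseteq> V \<and> A \<inter> B = {} \<and> A \<inter> S = {} \<and> B \<inter> S = {} \<and>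
        d_separated V E A B S \<longrightarrow> q_cond_indep d V \<rho> A B S)"

end

(*
  The graphical part only needs that quantum conditional independence is a semigraphoid: with the
  chain rule I(A : B C | S) = I(A : C | S) + I(A : B | C S), decomposition and weak union amount
  to the nonnegativity of I, that is, to strong subadditivity of the von Neumann entropy.

  Strong subadditivity is the monotonicity of relative entropy under tracing out B, applied to
  rho_ABC and 1 (x) rho_BC. With eigenvalues p_i, q_j and eigenvectors e_i, f_j of rho and sigma,
  the function G(s) = sum_ij |<f_j, e_i>|^2 p_i ln ((1 - s) q_j + s p_i) satisfies
  G(1) - G(0) = D(rho || sigma), and (1 - s) G'(s) + Tr rho is the quadratic form
  <rho, K^-1 rho> with K N = (1 - s) sigma N + s N rho, which equals
  max_N (2 Re <N, rho> - <N, K N>). Test operators of the form N (x) 1 give the same value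
  as N does for the marginals, so G' can only decrease when passing to marginals.

  From ordered to global, one removes the last vertex v of the ordering, which is a sink. If v is in
  A, the parents of v outside S can be added to A; if v separates, a walk from A to v and
  one from B to v cannot both be active, and v can be moved from S to A or B.
*)

theory Submission
  imports Defs
begin

section \<open>Semigraphoids and separation in directed acyclic graphs\<close>

text \<open>The analytic obstacle is that rho and sigma need not commute, so D(rho || sigma) cannot
  be computed in one common eigenbasis. The operator K explains the choice of G: left multiplication
  by sigma commutes with right multiplication by rho, so K is diagonal in the matrix units f_j
  e_i^dagger, with exactly the arguments of the logarithm in G as eigenvalues; differentiating ln
  therefore produces K^-1. A partial trace does not respect eigenbases, but it respects the
  quadratic forms under the maximum, which is the reason for the detour through test operators. The
  summand Tr rho is the same before and after a partial trace and drops out of the comparison. On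
  the graph side, walks may repeat vertices and a collider has to lie in S itself, so active walks
  can be glued without any search for shortest paths or for descendants in S. In the interior of a
  walk a sink is necessarily a collider; this is what makes sinks the vertices that can be
  removed.\<close>

lemma collider_rev:
  assumes "i < length p"
  shows "collider E (rev p) i \<longleftrightarrow> collider E p (length p - Suc i)"
proof (cases "0 < i \<and> Suc i < length p")
  case True
  then have "length p - Suc (i - 1) = Suc (length p - Suc i)"
    and "length p - Suc (Suc i) = length p - Suc i - 1"
    by auto
  with True show ?thesis
    by (auto simp: collider_def rev_nth)
qed (use assms in \<open>auto simp: collider_def\<close>)

lemma active_rev: "active E S (rev p) \<longleftrightarrow> active E S p"
proof -
  have "active E S (rev p)" if "active E S p" for p
    using that by (auto simp: active_def collider_rev rev_nth)
  from this[of p] this[of "rev p"] show ?thesis by auto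
qed

lemma walk_rev: "walk V E (rev p) \<longleftrightarrow> walk V E p"
  by (simp add: walk_def disj_commute)

lemma d_separated_sym:
  assumes "d_separated V E A B S"
  shows "d_separated V E B A S"
  unfolding d_separated_def
proof (intro allI impI)
  fix p assume p: "walk V E p \<and> hd p \<in> B \<and> last p \<in> A"
  then have "p \<noteq> []" by (auto simp: walk_def)
  with p have "walk V E (rev p)" "hd (rev p) \<in> A" "last (rev p) \<in> B"
    by (simp_all add: walk_rev hd_rev last_rev)
  with assms show "\<not> active E S p"
    unfolding d_separated_def by (metis active_rev)
qed

lemma d_separated_mono:
  assumes "d_separated V E A B S" "W \<subseteq> V"
  shows "d_separated W E A B S"
  using assms by (auto simp: d_separated_def walk_def)

lemma active_cong_set:
  assumes "set p \<inter> S = set p \<inter> S'"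
  shows "active E S p \<longleftrightarrow> active E S' p"
proof -
  have "p ! i \<in> S \<longleftrightarrow> p ! i \<in> S'" if "i < length p" for i
    using nth_mem[OF that] assms by blast
  then show ?thesis by (simp add: active_def)
qed

section \<open>Active walks near a sink\<close>

text \<open>Only the last position of \<open>p\<close> gets a new neighbour, and a collider there
  would need the arrow from \<open>v\<close> to \<open>last p\<close>.\<close>

lemma collider_append_sink:
  assumes "i < length p" and "(v, last p) \<notin> E"
  shows "collider E (p @ v # q) i \<longleftrightarrow> collider E p i"
proof (cases "Suc i < length p")
  case True
  then show ?thesis by (auto simp: collider_def nth_append)
next
  case False
  with assms have "Suc i = length p" by simp
  then have "last p = p ! i"
    by (metis diff_Suc_1 last_conv_nth length_0_conv nat.distinct(1))
  with \<open>Suc i = length p\<close> have "(p @ v # q) ! i = last p" "(p @ v # q) ! Suc i = v"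
    by (auto simp: nth_append)
  with assms \<open>Suc i = length p\<close> show ?thesis by (simp add: collider_def)
qed

text \<open>As an endpoint \<open>v\<close> is a non-collider, and \<open>hd p\<close> stays a
  non-collider because \<open>v\<close> does not point to it.\<close>

lemma active_Cons_sink:
  assumes "p \<noteq> []" and "(v, hd p) \<notin> E"
  shows "active E S (v # p) \<longleftrightarrow> v \<notin> S \<and> active E S p"
proof -
  have *: "collider E (v # p) (Suc i) \<longleftrightarrow> collider E p i" for i
    using assms by (cases i) (auto simp: collider_def hd_conv_nth)
  show ?thesis
    unfolding active_def
    by (auto simp: All_less_Suc2 * ) (auto simp: collider_def)
qed

text \<open>Both neighbours of the new \<open>v\<close> point to it, so it is a collider, as
  membership in \<open>S\<close> demands; the former endpoints stay non-colliders because
  \<open>v\<close> points to neither.\<close>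

lemma active_join_collider:
  assumes p: "p \<noteq> []" "(last p, v) \<in> E" "(v, last p) \<notin> E" "active E S p"
    and q: "q \<noteq> []" "(hd q, v) \<in> E" "(v, hd q) \<notin> E" "active E S q"
    and "v \<in> S"
  shows "active E S (p @ v # q)"
  unfolding active_def
proof (intro allI impI)
  fix i assume i: "i < length (p @ v # q)"
  consider "i < length p" | "i = length p" | j where "i = length p + Suc j" "j < length q"
  proof (cases "i \<le> length p")
    case False
    then obtain j where "i = length p + Suc j"
      by (metis add_Suc_right less_imp_Suc_add not_le)
    with i that(3) show ?thesis by simp
  qed (use that in fastforce)
  then show "collider E (p @ v # q) i \<longleftrightarrow> (p @ v # q) ! i \<in> S"
  proof cases
    case 1
    with p show ?thesis by (simp add: collider_append_sink nth_append active_def)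
  next
    case 2
    with p q \<open>v \<in> S\<close> show ?thesis
      by (simp add: collider_def nth_append last_conv_nth hd_conv_nth)
  next
    case 3
    have "collider E (p @ v # q) i \<longleftrightarrow> collider E q j"
      using 3 q p by (cases j) (auto simp: collider_def nth_append hd_conv_nth)
    moreover have "(p @ v # q) ! i = q ! j"
      using 3 by (metis nth_append_length_plus nth_Cons_Suc)
    ultimately show ?thesis using 3 q by (simp add: active_def)
  qed
qed

text \<open>Both edges at an interior occurrence of \<open>v\<close> must point to \<open>v\<close>,
  which has no arrow into \<open>W\<close>. It would thus be a collider, and activity forbids that
  outside \<open>S\<close>.\<close>

lemma active_walk_avoids_sink:
  assumes "walk W E p" "active E S p" "v \<notin> S" "\<And>w. w \<in> W \<Longrightarrow> (v, w) \<notin> E"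
    and "0 < i" "Suc i < length p"
  shows "p ! i \<noteq> v"
proof
  assume "p ! i = v"
  have adj: "(p ! j, p ! Suc j) \<in> E \<or> (p ! Suc j, p ! j) \<in> E" if "Suc j < length p" for j
    using assms(1) that by (auto simp: walk_def successively_conv_nth)
  have "p ! (i - 1) \<in> W" "p ! Suc i \<in> W"
    using assms by (auto simp: walk_def)
  with assms(4) \<open>p ! i = v\<close> have "(p ! i, p ! (i - 1)) \<notin> E" "(p ! i, p ! Suc i) \<notin> E"
    by auto
  with adj[of i] adj[of "i - 1"] assms(5,6) have "collider E p i"
    by (auto simp: collider_def)
  with assms \<open>p ! i = v\<close> show False
    unfolding active_def by (metis Suc_lessD)
qed

lemma active_walk_not_mem_sink:
  assumes "walk W E p" "active E S p" "v \<notin> S" "\<And>w. w \<in> W \<Longrightarrow> (v, w) \<notin> E"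
    and "hd p \<noteq> v" "last p \<noteq> v"
  shows "v \<notin> set p"
proof
  assume "v \<in> set p"
  then obtain i where i: "i < length p" "p ! i = v" by (auto simp: in_set_conv_nth)
  with assms have "i \<noteq> 0"
    by (metis hd_conv_nth length_greater_0_conv not_less_zero)
  moreover have "Suc i \<noteq> length p"
    using assms i by (metis diff_Suc_1 last_conv_nth list.size(3) nat.distinct(1))
  ultimately show False
    using active_walk_avoids_sink[OF assms(1-4), of i] i by simp
qed

text \<open>The walk must leave \<open>v\<close> against an arrow, and the rest, being active
  itself, cannot meet \<open>v\<close> in its interior.\<close>

lemma active_walk_from_sink:
  assumes "walk (insert v W) E p" "active E S p" "v \<notin> S"
    and sink: "\<And>w. w \<in> insert v W \<Longrightarrow> (v, w) \<notin> E"
    and "hd p = v" "last p \<noteq> v"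
  obtains q where "p = v # q" "walk W E q" "(hd q, v) \<in> E" "active E S q"
proof -
  from assms obtain q where q: "p = v # q"
    by (metis list.collapse walk_def)
  with assms have ne: "q \<noteq> []" by auto
  have walk: "walk (insert v W) E q"
    using assms(1) ne q by (auto simp: walk_def successively_Cons)
  then have "hd q \<in> insert v W" using hd_in_set[OF ne] by (metis subsetD walk_def)
  then have hd: "(hd q, v) \<in> E"
    using assms(1) ne sink[of "hd q"] q by (auto simp: walk_def successively_Cons)
  have "hd q \<noteq> v"
    using hd sink[of v] by auto
  have act: "active E S q"
    using assms(2) ne sink[OF \<open>hd q \<in> insert v W\<close>] q by (auto simp: active_Cons_sink)
  have "v \<notin> set q"
    using active_walk_not_mem_sink[OF walk act assms(3) sink] \<open>hd q \<noteq> v\<close> assms(6) q ne by auto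
  with walk have "walk W E q" by (auto simp: walk_def)
  with q hd act that show ?thesis by blast
qed

section \<open>From the ordered to the global property in a semigraphoid\<close>

text \<open>\<open>decomposition\<close> and \<open>weak_union\<close> carry disjointness and
  inclusion in \<open>V\<close> because for I they come from strong subadditivity;
  \<open>symmetry\<close> and \<open>contraction\<close> are unrestricted, since they follow from
  identities between entropies.\<close>

locale semigraphoid =
  fixes V :: "'v set" and ci :: "'v set \<Rightarrow> 'v set \<Rightarrow> 'v set \<Rightarrow> bool"
  assumes empty: "ci {} B S"
    and symmetry: "ci A B S \<Longrightarrow> ci B A S"
    and decomposition:
      "\<lbrakk>A \<union> B \<union> C \<union> S \<subseteq> V; A \<inter> B = {}; A \<inter> C = {}; A \<inter> S = {}; B \<inter> C = {}; B \<inter> S = {}; C \<inter> S = {};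
        ci A (B \<union> C) S\<rbrakk> \<Longrightarrow> ci A B S"
    and weak_union:
      "\<lbrakk>A \<union> B \<union> C \<union> S \<subseteq> V; A \<inter> B = {}; A \<inter> C = {}; A \<inter> S = {}; B \<inter> C = {}; B \<inter> S = {}; C \<inter> S = {};
        ci A (B \<union> C) S\<rbrakk> \<Longrightarrow> ci A B (C \<union> S)"
    and contraction: "\<lbrakk>ci A C S; ci A B (C \<union> S)\<rbrakk> \<Longrightarrow> ci A (B \<union> C) S"
begin

lemma decomposition_subset:
  assumes "ci A B' S" "B \<subseteq> B'" "A \<union> B' \<union> S \<subseteq> V" "A \<inter> B' = {}" "A \<inter> S = {}" "B' \<inter> S = {}"
  shows "ci A B S"
proof -
  have "ci A (B \<union> (B' - B)) S" using assms(1,2) by (simp add: Un_absorb1)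
  then show ?thesis using assms(2-) by (elim decomposition[rotated -1]) auto
qed

text \<open>The inductive step at a fixed sink \<open>v\<close>: \<open>W\<close> stands for the
  vertices before \<open>v\<close>, \<open>local\<close> for the ordered property at
  \<open>v\<close>, and \<open>IH\<close> for the global property of the graph on \<open>W\<close>,
  where walks stay inside \<open>W\<close>.\<close>

context
  fixes W :: "'v set" and E :: "('v \<times> 'v) set" and v :: 'v
  assumes WV: "insert v W \<subseteq> V" and vW: "v \<notin> W"
    and sink: "\<And>w. w \<in> insert v W \<Longrightarrow> (v, w) \<notin> E"
    and parents: "parents E v \<subseteq> W"
    and local: "ci {v} (W - parents E v) (parents E v)"
    and IH: "\<And>A B S. \<lbrakk>A \<subseteq> W; B \<subseteq> W; S \<subseteq> W; A \<inter> B = {}; A \<inter> S = {}; B \<inter> S = {};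
      d_separated W E A B S\<rbrakk> \<Longrightarrow> ci A B S"
begin

text \<open>With \<open>A\<close> enlarged to \<open>?Q\<close>, the set
  \<open>?Q \<union> S\<close> contains all parents of \<open>v\<close>. Then \<open>B\<close> is
  independent of \<open>?Q\<close> given \<open>S\<close> by induction, and of \<open>v\<close>
  given \<open>?Q \<union> S\<close> by \<open>local\<close>; contraction combines the two.\<close>

lemma ci_insert_sink_left:
  assumes sub: "A \<subseteq> W" "B \<subseteq> W" "S \<subseteq> W" and disj: "A \<inter> B = {}" "A \<inter> S = {}" "B \<inter> S = {}"
    and sep: "d_separated (insert v W) E (insert v A) B S"
  shows "ci (insert v A) B S"
proof -
  let ?P = "parents E v"
  let ?Q = "A \<union> (?P - S)"
  have vS: "v \<notin> S" using sub vW by auto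
  \<comment> \<open>An active walk from a parent of \<open>v\<close> to \<open>B\<close> could be
    prolonged by \<open>v\<close> at the front, against \<open>sep\<close>.\<close>
  have extend: "\<not> active E S p" if p: "walk W E p" "hd p \<in> ?P" "hd p \<notin> S \<or> active E S p" "last p \<in> B" for p
  proof
    assume act: "active E S p"
    have ne: "p \<noteq> []" and "hd p \<in> W" using p by (auto simp: walk_def)
    then have "active E S (v # p)"
      using act vS sink[of "hd p"] by (simp add: active_Cons_sink)
    moreover have "walk (insert v W) E (v # p)"
      using p ne by (auto simp: walk_def successively_Cons parents_def)
    moreover have "last (v # p) \<in> B" using p ne by simp
    ultimately show False
      using sep unfolding d_separated_def by (metis insertI1 list.sel(1))
  qed
  \<comment> \<open>A parent of \<open>v\<close> in \<open>B\<close> would be an active walk of one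
    vertex, since \<open>B\<close> is disjoint from \<open>S\<close>.\<close>
  have PB: "?P \<inter> B = {}"
  proof (rule ccontr)
    assume "?P \<inter> B \<noteq> {}"
    then obtain b where b: "b \<in> ?P" "b \<in> B" by auto
    then have "walk W E [b]" "active E S [b]"
      using sub disj by (auto simp: walk_def active_def collider_def)
    with extend[of "[b]"] b show False by simp
  qed
  have "d_separated W E ?Q B S"
    unfolding d_separated_def
  proof (intro allI impI notI)
    fix p assume p: "walk W E p \<and> hd p \<in> ?Q \<and> last p \<in> B" and act: "active E S p"
    have "walk (insert v W) E p" using p by (auto simp: walk_def)
    then have "hd p \<notin> insert v A"
      using sep act p unfolding d_separated_def by blast
    with p extend[of p] act show False by auto
  qed
  then have 1: "ci B ?Q S"
    using sub disj PB parents by (intro symmetry[OF IH]) auto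
  \<comment> \<open>Next to \<open>B\<close>, the part of \<open>A \<union> S\<close> outside the
    parents is kept, so that weak union can move it into the condition and complete that to
    \<open>?Q \<union> S\<close>.\<close>
  have "ci {v} (B \<union> (A \<union> S - ?P)) ?P"
    using sub PB WV vW parents by (intro decomposition_subset[OF local]) auto
  then have "ci {v} B ((A \<union> S - ?P) \<union> ?P)"
    using sub disj PB WV vW parents by (intro weak_union) auto
  moreover have "(A \<union> S - ?P) \<union> ?P = ?Q \<union> S" by auto
  ultimately have "ci B {v} (?Q \<union> S)" by (auto intro: symmetry)
  with 1 have "ci B ({v} \<union> ?Q) S" by (rule contraction)
  then have "ci B (insert v A) S"
    using sub disj PB WV vW parents by (elim decomposition_subset) auto
  then show ?thesis by (rule symmetry)
qed

text \<open>Walks from \<open>A\<close> to \<open>B\<close> that are active relative to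
  \<open>S\<close> avoid the sink \<open>v\<close>, so they stay active when \<open>v\<close> joins
  the separator. Hence \<open>S\<close> separates \<open>A\<close> together with \<open>v\<close>
  from \<open>B\<close>, and weak union puts \<open>v\<close> back into the condition.\<close>

lemma ci_sink_in_separator:
  assumes sub: "A \<subseteq> W" "B \<subseteq> W" "S \<subseteq> W" and disj: "A \<inter> B = {}" "A \<inter> S = {}" "B \<inter> S = {}"
    and sep: "d_separated (insert v W) E A B (insert v S)"
    and sepv: "d_separated (insert v W) E {v} B S"
  shows "ci A B (insert v S)"
proof -
  have "d_separated (insert v W) E (insert v A) B S"
    unfolding d_separated_def
  proof (intro allI impI notI)
    fix p assume p: "walk (insert v W) E p \<and> hd p \<in> insert v A \<and> last p \<in> B" and act: "active E S p"
    have "hd p \<noteq> v" using sepv p act by (auto simp: d_separated_def)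
    moreover have "last p \<noteq> v" "v \<notin> S" using p sub vW by auto
    ultimately have "v \<notin> set p"
      using active_walk_not_mem_sink[OF _ act _ sink] p by blast
    then have "active E (insert v S) p"
      using act active_cong_set[of p S "insert v S"] by auto
    with sep p \<open>hd p \<noteq> v\<close> show False by (auto simp: d_separated_def)
  qed
  then have "ci B (A \<union> {v}) S"
    using ci_insert_sink_left[OF sub disj] symmetry by simp
  then have "ci B A ({v} \<union> S)"
    using sub disj WV vW by (intro weak_union) auto
  then show ?thesis using symmetry by simp
qed

text \<open>If both failed, active walks from \<open>v\<close> to \<open>A\<close> and to
  \<open>B\<close>, glued at \<open>v\<close>, would form a walk from \<open>A\<close> to
  \<open>B\<close> with \<open>v\<close> as a collider inside the separator.\<close>

lemma d_separated_sink_cases: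
  assumes sub: "A \<subseteq> W" "B \<subseteq> W" "S \<subseteq> W"
    and sep: "d_separated (insert v W) E A B (insert v S)"
  shows "d_separated (insert v W) E {v} A S \<or> d_separated (insert v W) E {v} B S"
proof (rule ccontr)
  have vS: "v \<notin> S" using sub vW by auto
  assume "\<not> ?thesis"
  then obtain p q where
    p: "walk (insert v W) E p" "hd p = v" "last p \<in> A" "active E S p" and
    q: "walk (insert v W) E q" "hd q = v" "last q \<in> B" "active E S q"
    by (auto simp: d_separated_def)
  have "last p \<noteq> v" "last q \<noteq> v" using p q sub vW by auto
  then obtain p' q' where
    p': "p = v # p'" "walk W E p'" "(hd p', v) \<in> E" "active E S p'" and
    q': "q = v # q'" "walk W E q'" "(hd q', v) \<in> E" "active E S q'"
    using active_walk_from_sink[OF p(1,4) vS sink p(2)] active_walk_from_sink[OF q(1,4) vS sink q(2)]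
    by metis
  have ne: "p' \<noteq> []" "q' \<noteq> []" using p' q' by (auto simp: walk_def)
  have "v \<notin> set p'" "v \<notin> set q'" using p' q' vW by (auto simp: walk_def)
  then have act: "active E (insert v S) (rev p')" "active E (insert v S) q'"
    using p' q' active_cong_set[of p' S "insert v S"] active_cong_set[of q' S "insert v S"]
    by (auto simp: active_rev)
  have "hd p' \<in> W" "hd q' \<in> W" using p' q' ne by (auto simp: walk_def)
  then have "active E (insert v S) (rev p' @ v # q')"
    using p' q' ne act sink by (intro active_join_collider) (auto simp: last_rev)
  moreover have "walk W E (rev p')" using p' by (simp add: walk_rev)
  then have "walk (insert v W) E (rev p' @ v # q')"
    using p' q' ne by (auto simp: walk_def successively_append_iff successively_Cons last_rev)
  moreover have "hd (rev p' @ v # q') \<in> A" "last (rev p' @ v # q') \<in> B"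
    using p q p' q' ne by (auto simp: hd_append hd_rev)
  ultimately show False using sep unfolding d_separated_def by blast
qed

lemma global_insert_sink:
  assumes sub: "A \<subseteq> insert v W" "B \<subseteq> insert v W" "S \<subseteq> insert v W"
    and disj: "A \<inter> B = {}" "A \<inter> S = {}" "B \<inter> S = {}"
    and sep: "d_separated (insert v W) E A B S"
  shows "ci A B S"
proof -
  consider "v \<in> A" | "v \<in> B" | "v \<in> S" | "v \<notin> A" "v \<notin> B" "v \<notin> S" by blast
  then show ?thesis
  proof cases
    case 1
    then have "ci (insert v (A - {v})) B S"
      using sub disj sep by (intro ci_insert_sink_left) (auto simp: insert_absorb)
    with 1 show ?thesis by (simp add: insert_absorb)
  next
    case 2
    then have "ci (insert v (B - {v})) A S"
      using sub disj d_separated_sym[OF sep] by (intro ci_insert_sink_left) (auto simp: insert_absorb)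
    with 2 show ?thesis by (auto simp: insert_absorb intro: symmetry)
  next
    case 3
    then have S: "S = insert v (S - {v})" by auto
    have sub': "A \<subseteq> W" "B \<subseteq> W" "S - {v} \<subseteq> W"
      and disj': "A \<inter> B = {}" "A \<inter> (S - {v}) = {}" "B \<inter> (S - {v}) = {}"
      using sub disj 3 by auto
    have sep': "d_separated (insert v W) E A B (insert v (S - {v}))" using sep S by simp
    from d_separated_sink_cases[OF sub' sep'] show ?thesis
    proof
      assume "d_separated (insert v W) E {v} B (S - {v})"
      from ci_sink_in_separator[OF sub' disj' sep' this] S show ?thesis by simp
    next
      assume *: "d_separated (insert v W) E {v} A (S - {v})"
      have "ci B A (insert v (S - {v}))"
        using disj' by (intro ci_sink_in_separator[OF sub'(2,1,3) _ _ _ d_separated_sym[OF sep'] *]) auto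
      with S show ?thesis using symmetry by simp
    qed
  next
    \<comment> \<open>With \<open>v\<close> in none of the sets, fewer walks need to be blocked in
      \<open>W\<close>, so the separation is inherited.\<close>
    case 4
    then show ?thesis
      using sub disj by (intro IH d_separated_mono[OF sep]) auto
  qed
qed

end

text \<open>Induction over initial segments \<open>W\<close> of the ordering: the largest vertex of
  \<open>W\<close> is a sink there, and its predecessors are exactly the rest of \<open>W\<close>,
  so the ordered property at this vertex is the \<open>local\<close> hypothesis of the inductive
  step.\<close>

theorem ordered_imp_global:
  assumes "finite V" "topological_ordering V E r"
    and ordered: "\<And>v. v \<in> V \<Longrightarrow> ci {v} (predecessors V r v - parents E v) (parents E v)"
    and ABS: "A \<subseteq> V" "B \<subseteq> V" "S \<subseteq> V" "A \<inter> B = {}" "A \<inter> S = {}" "B \<inter> S = {}"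
      "d_separated V E A B S"
  shows "ci A B S"
proof -
  have r: "r \<subseteq> V \<times> V" "trans r" "irrefl r" "total_on V r" "E \<subseteq> r"
    using assms(2) by (auto simp: topological_ordering_def strict_linear_order_on_def)
  have "finite r" using r assms(1) by (meson finite_SigmaI finite_subset)
  moreover have acyc: "acyclic r" using r by (simp add: acyclic_irrefl trancl_id)
  ultimately have wf: "wf (r\<inverse>)" by (rule finite_acyclic_wf_converse)
  have "ci A B S"
    if "W \<subseteq> V" "\<And>u w. w \<in> W \<Longrightarrow> (u, w) \<in> r \<Longrightarrow> u \<in> W"
      and "A \<subseteq> W" "B \<subseteq> W" "S \<subseteq> W" "A \<inter> B = {}" "A \<inter> S = {}" "B \<inter> S = {}" "d_separated W E A B S"
    for W A B S
    using finite_subset[OF that(1) assms(1)] that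
  proof (induction "card W" arbitrary: W A B S)
    case 0
    then have "A = {}" by auto
    then show ?case by (simp add: empty)
  next
    case (Suc n)
    then obtain v where v: "v \<in> W" "\<And>w. (v, w) \<in> r \<Longrightarrow> w \<notin> W"
      using wf by (metis card.empty converse_iff ex_in_conv nat.distinct(1) wfE_min)
    define W' where "W' = W - {v}"
    have W: "W = insert v W'" "v \<notin> W'" using v by (auto simp: W'_def)
    have pre: "predecessors V r v = W'"
    proof (intro set_eqI iffI)
      fix u assume "u \<in> predecessors V r v"
      then show "u \<in> W'"
        using Suc.prems(3) v r(3) by (auto simp: predecessors_def W'_def irrefl_def)
    next
      fix u assume u: "u \<in> W'"
      then have "(v, u) \<notin> r" using v by (auto simp: W'_def)
      with r(4) u v Suc.prems show "u \<in> predecessors V r v"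
        by (auto simp: predecessors_def W'_def total_on_def)
    qed
    have sink: "(v, w) \<notin> E" if "w \<in> insert v W'" for w
      using that v r(5) W by blast
    have parents: "parents E v \<subseteq> W'"
      unfolding pre[symmetric] using r by (auto simp: parents_def predecessors_def)
    have local: "ci {v} (W' - parents E v) (parents E v)"
      using ordered[of v] v Suc.prems(2) pre by auto
    have card: "n = card W'" using Suc.hyps(2) Suc.prems(1) W by simp
    have down: "u \<in> W'" if "w \<in> W'" "(u, w) \<in> r" for u w
      using that v Suc.prems(3) by (auto simp: W'_def)
    have IH: "ci A B S" if "A \<subseteq> W'" "B \<subseteq> W'" "S \<subseteq> W'" "A \<inter> B = {}" "A \<inter> S = {}" "B \<inter> S = {}"
      "d_separated W' E A B S" for A B S
      using Suc.hyps(1)[OF card _ _ _ that] down Suc.prems(1,2) W by auto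
    show ?case
      using Suc.prems W by (intro global_insert_sink[OF _ W(2) sink parents local IH]) auto
  qed
  from this[OF subset_refl _ ABS] r(1) show ?thesis by auto
qed

end

section \<open>From the global to the local and the ordered property\<close>

text \<open>An active walk from \<open>v\<close> cannot start towards a parent, which would have to
  be a collider and hence a child as well. So it starts along an arrow, and its first reversal of
  direction would be a collider: a parent of \<open>v\<close> that descends from \<open>v\<close>.
  The walk is therefore directed and ends in a descendant.\<close>

lemma d_separated_nondescendants:
  assumes "dag V E" "v \<in> V"
  shows "d_separated V E {v} (nondescendants V E v - parents E v) (parents E v)"
  unfolding d_separated_def
proof (intro allI impI notI)
  fix p
  assume p: "walk V E p \<and> hd p \<in> {v} \<and> last p \<in> nondescendants V E v - parents E v"
    and act: "active E (parents E v) p"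
  have acyc: "(x, x) \<notin> E\<^sup>+" for x using assms by (auto simp: dag_def acyclic_def)
  have ne: "p \<noteq> []" using p by (auto simp: walk_def)
  have adj: "(p ! i, p ! Suc i) \<in> E \<or> (p ! Suc i, p ! i) \<in> E" if "Suc i < length p" for i
    using p that by (auto simp: walk_def successively_conv_nth)
  have p0: "p ! 0 = v" using p ne by (simp add: hd_conv_nth)
  have step: "(p ! i, p ! Suc i) \<in> E \<and> (v, p ! Suc i) \<in> E\<^sup>+" if "Suc i < length p" for i
    using that
  proof (induction i)
    case 0
    have "(p ! 1, v) \<notin> E"
    proof
      assume *: "(p ! 1, v) \<in> E"
      then have "p ! 1 \<in> parents E v" by (simp add: parents_def)
      with act 0 have "collider E p 1" by (simp add: active_def)
      then have "(v, p ! 1) \<in> E" by (simp add: collider_def p0)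
      with * acyc show False by (meson trancl.simps)
    qed
    with adj[OF 0] p0 show ?case by auto
  next
    case (Suc i)
    then have IH: "(p ! i, p ! Suc i) \<in> E" "(v, p ! Suc i) \<in> E\<^sup>+" by auto
    have "(p ! Suc (Suc i), p ! Suc i) \<notin> E"
    proof
      assume "(p ! Suc (Suc i), p ! Suc i) \<in> E"
      with IH Suc.prems have "collider E p (Suc i)" by (simp add: collider_def)
      with act Suc.prems have "p ! Suc i \<in> parents E v" by (simp add: active_def)
      with IH acyc show False by (auto simp: parents_def intro: trancl_into_trancl)
    qed
    with adj[OF Suc.prems] IH show ?case by (auto intro: trancl_into_trancl)
  qed
  \<comment> \<open>A walk of one vertex would end in \<open>v\<close>; so there is a final step,
    which starts at index \<open>length p - 2\<close>.\<close>
  have "last p \<noteq> v" using p by (auto simp: nondescendants_def)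
  with p ne have "length p \<noteq> 1"
    by (metis One_nat_def diff_Suc_1 last_conv_nth p0)
  with ne have "Suc (length p - 2) = length p - 1" "Suc (length p - 2) < length p"
    by (cases p; auto simp: neq_Nil_conv Suc_diff_le)+
  with step[of "length p - 2"] ne have "(v, last p) \<in> E\<^sup>+" by (simp add: last_conv_nth)
  with p acyc show False by (auto simp: nondescendants_def descendants_def)
qed

text \<open>\<open>E\<^sup>+\<close> lies in the transitive relation \<open>r\<close>, so a
  descendant of \<open>v\<close> cannot come before \<open>v\<close>.\<close>

lemma predecessors_subset_nondescendants:
  assumes "topological_ordering V E r"
  shows "predecessors V r v \<subseteq> nondescendants V E v"
proof -
  have r: "trans r" "irrefl r" "E \<subseteq> r"
    using assms by (auto simp: topological_ordering_def strict_linear_order_on_def)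
  then have "E\<^sup>+ \<subseteq> r" by (metis trancl_id trancl_mono_subset)
  with r show ?thesis
    unfolding predecessors_def nondescendants_def descendants_def irrefl_def
    by (auto dest: transD)
qed

section \<open>The spectral theorem for self-adjoint matrices\<close>

definition cinner :: "'i set \<Rightarrow> ('i \<Rightarrow> complex) \<Rightarrow> ('i \<Rightarrow> complex) \<Rightarrow> complex" where
  "cinner X u v = (\<Sum>x\<in>X. cnj (u x) * v x)"

definition op_app :: "'i set \<Rightarrow> 'i op \<Rightarrow> ('i \<Rightarrow> complex) \<Rightarrow> 'i \<Rightarrow> complex" where
  "op_app X M u = (\<lambda>x. \<Sum>y\<in>X. M x y * u y)"

lemma orthonormal_basis_iff_cinner:
  "orthonormal_basis X e \<longleftrightarrow> (\<forall>j\<in>X. \<forall>k\<in>X. cinner X (e j) (e k) = (if j = k then 1 else 0))"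
  by (simp add: orthonormal_basis_def cinner_def)

lemma cinner_cnj: "cnj (cinner X u v) = cinner X v u"
  by (simp add: cinner_def mult.commute)

lemma cinner_diff_left: "cinner X (\<lambda>x. u x - v x) w = cinner X u w - cinner X v w"
  and cinner_diff_right: "cinner X u (\<lambda>x. v x - w x) = cinner X u v - cinner X u w"
  and cinner_mult_left: "cinner X (\<lambda>x. c * u x) v = cnj c * cinner X u v"
  and cinner_mult_right: "cinner X u (\<lambda>x. c * v x) = c * cinner X u v"
  by (simp_all add: cinner_def sum.distrib sum_subtractf algebra_simps sum_distrib_left)

lemma cinner_sum_left: "cinner X (\<lambda>x. \<Sum>k\<in>K. u k x) v = (\<Sum>k\<in>K. cinner X (u k) v)"
  and cinner_sum_right: "cinner X v (\<lambda>x. \<Sum>k\<in>K. u k x) = (\<Sum>k\<in>K. cinner X v (u k))"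
  unfolding cinner_def
  by (simp_all add: sum_distrib_left sum_distrib_right) (rule sum.swap)+

lemma cinner_cong:
  "(\<And>x. x \<in> X \<Longrightarrow> u x = u' x) \<Longrightarrow> (\<And>x. x \<in> X \<Longrightarrow> v x = v' x) \<Longrightarrow> cinner X u v = cinner X u' v'"
  by (simp add: cinner_def)

lemma cinner_self: "cinner X u u = of_real (\<Sum>x\<in>X. (cmod (u x))\<^sup>2)"
  unfolding cinner_def of_real_sum by (intro sum.cong refl) (simp add: complex_norm_square mult.commute del: of_real_power)

lemma cinner_self_eq_1_iff: "cinner X u u = 1 \<longleftrightarrow> (\<Sum>x\<in>X. (cmod (u x))\<^sup>2) = 1"
  by (simp only: cinner_self of_real_eq_1_iff)

lemma cinner_self_eq_0_iff: "finite X \<Longrightarrow> cinner X u u = 0 \<longleftrightarrow> (\<forall>x\<in>X. u x = 0)"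
  by (simp add: cinner_self sum_nonneg_eq_0_iff del: of_real_sum)

lemma cinner_self_adjoint:
  assumes "self_adjoint X M"
  shows "cinner X (op_app X M u) v = cinner X u (op_app X M v)"
proof -
  have sa: "cnj (M x y) = M y x" if "x \<in> X" "y \<in> X" for x y
    using assms that unfolding self_adjoint_def by metis
  have "cinner X (op_app X M u) v = (\<Sum>x\<in>X. \<Sum>y\<in>X. cnj (M x y) * cnj (u y) * v x)"
    by (simp add: cinner_def op_app_def sum_distrib_right)
  also have "\<dots> = (\<Sum>y\<in>X. \<Sum>x\<in>X. cnj (M x y) * cnj (u y) * v x)" by (rule sum.swap)
  also have "\<dots> = (\<Sum>y\<in>X. \<Sum>x\<in>X. cnj (u y) * (M y x * v x))"
    by (intro sum.cong refl) (simp add: sa)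
  finally show ?thesis by (simp add: cinner_def op_app_def sum_distrib_left)
qed

definition indic :: "'i \<Rightarrow> 'i \<Rightarrow> complex" where
  "indic x y = (if y = x then 1 else 0)"

lemma cinner_indic:
  assumes "finite X" "x \<in> X"
  shows "cinner X (indic x) u = u x" "cinner X u (indic x) = cnj (u x)"
  using assms by (simp_all add: cinner_def indic_def if_distrib[of "\<lambda>c. cnj c * _"] if_distrib[of "\<lambda>c. _ * c"] cong: if_cong)

section \<open>Orthonormal families and eigenvectors\<close>

text \<open>The component of the coordinate vector \<open>indic x\<close> orthogonal to the family;
  \<open>cnj (e k x)\<close> is the inner product of \<open>e k\<close> with
  \<open>indic x\<close>.\<close>

definition residual :: "('k \<Rightarrow> 'i \<Rightarrow> complex) \<Rightarrow> 'k set \<Rightarrow> 'i \<Rightarrow> 'i \<Rightarrow> complex" where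
  "residual e K x = (\<lambda>y. indic x y - (\<Sum>k\<in>K. cnj (e k x) * e k y))"

context
  fixes X :: "'i set" and K :: "'k set" and e :: "'k \<Rightarrow> 'i \<Rightarrow> complex"
  assumes fin: "finite X" "finite K"
    and orth: "\<And>j k. j \<in> K \<Longrightarrow> k \<in> K \<Longrightarrow> cinner X (e j) (e k) = (if j = k then 1 else 0)"
begin

lemma cinner_residual:
  assumes "x \<in> X" "j \<in> K"
  shows "cinner X (e j) (residual e K x) = 0"
proof -
  have "(\<Sum>k\<in>K. cnj (e k x) * cinner X (e j) (e k)) = (\<Sum>k\<in>K. if k = j then cnj (e k x) else 0)"
    using orth assms by (intro sum.cong) auto
  then show ?thesis
    using assms fin
    by (simp add: residual_def cinner_diff_right cinner_sum_right cinner_mult_right cinner_indic)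
qed

lemma cinner_residual_self:
  assumes "x \<in> X"
  shows "cinner X (residual e K x) (residual e K x) = of_real (1 - (\<Sum>k\<in>K. (cmod (e k x))\<^sup>2))"
proof -
  have "cinner X (residual e K x) (residual e K x) = cinner X (indic x) (residual e K x)"
    using assms cinner_residual[OF assms]
    by (subst residual_def) (simp add: cinner_diff_left cinner_sum_left cinner_mult_left)
  also have "\<dots> = 1 - (\<Sum>k\<in>K. cnj (e k x) * e k x)"
    using assms fin by (simp add: cinner_indic) (simp add: residual_def indic_def)
  also have "(\<Sum>k\<in>K. cnj (e k x) * e k x) = of_real (\<Sum>k\<in>K. (cmod (e k x))\<^sup>2)"
    unfolding of_real_sum by (intro sum.cong refl) (simp add: complex_norm_square mult.commute del: of_real_power)
  finally show ?thesis by simp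
qed

text \<open>By \<open>cinner_residual_self\<close> the summands are squared norms of residuals;
  together they form the trace of the projection onto the orthogonal complement of the
  family.\<close>

lemma sum_norm_residual:
  "(\<Sum>x\<in>X. 1 - (\<Sum>k\<in>K. (cmod (e k x))\<^sup>2)) = real (card X) - real (card K)"
proof -
  have "(\<Sum>x\<in>X. (cmod (e k x))\<^sup>2) = 1" if "k \<in> K" for k
    using orth[OF that that] by (simp add: cinner_self_eq_1_iff)
  then have "(\<Sum>k\<in>K. \<Sum>x\<in>X. (cmod (e k x))\<^sup>2) = real (card K)" by simp
  then show ?thesis by (simp add: sum_subtractf sum.swap[of _ X K])
qed

lemma norm_residual_nonneg:
  assumes "x \<in> X"
  shows "0 \<le> 1 - (\<Sum>k\<in>K. (cmod (e k x))\<^sup>2)"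
proof -
  have "(\<Sum>y\<in>X. (cmod (residual e K x y))\<^sup>2) = 1 - (\<Sum>k\<in>K. (cmod (e k x))\<^sup>2)"
    using cinner_residual_self[OF assms] by (simp only: cinner_self of_real_eq_iff)
  moreover have "0 \<le> (\<Sum>y\<in>X. (cmod (residual e K x y))\<^sup>2)" by (intro sum_nonneg) simp
  ultimately show ?thesis by simp
qed

text \<open>The squared norms of the residuals have a positive sum, so some residual is nonzero and
  can be normalised. Cutting it off outside \<open>X\<close> makes it a point of the compact set
  used below for the maximisation.\<close>

lemma exists_orthogonal:
  assumes "card K < card X"
  shows "\<exists>u. cinner X u u = 1 \<and> (\<forall>j\<in>K. cinner X (e j) u = 0) \<and> (\<forall>x. x \<notin> X \<longrightarrow> u x = 0)"
proof -
  have "(\<Sum>x\<in>X. 1 - (\<Sum>k\<in>K. (cmod (e k x))\<^sup>2)) > 0"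
    using assms by (simp add: sum_norm_residual)
  then obtain x where x: "x \<in> X" "1 - (\<Sum>k\<in>K. (cmod (e k x))\<^sup>2) > 0"
    by (meson not_le sum_nonpos)
  define n where "n = 1 - (\<Sum>k\<in>K. (cmod (e k x))\<^sup>2)"
  define v where "v = (\<lambda>y. of_real (1 / sqrt n) * residual e K x y)"
  define u where "u = (\<lambda>y. if y \<in> X then v y else 0)"
  have n: "n > 0" using x n_def by simp
  have uv: "cinner X u u = cinner X v v" "cinner X w u = cinner X w v" for w
    by (auto simp: u_def intro: cinner_cong)
  have "cinner X v v = of_real (1 / sqrt n) * (of_real (1 / sqrt n) * of_real n)"
    using cinner_residual_self[OF x(1)]
    by (simp only: v_def cinner_mult_left cinner_mult_right n_def complex_cnj_complex_of_real)
  also have "\<dots> = of_real (1 / sqrt n * (1 / sqrt n * n))" by (simp only: of_real_mult)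
  also have "1 / sqrt n * (1 / sqrt n * n) = 1"
    using n by (simp add: field_simps)
  finally have "cinner X u u = 1" using uv by simp
  moreover have "cinner X (e j) u = 0" if "j \<in> K" for j
    using cinner_residual[OF x(1) that] by (simp only: uv v_def cinner_mult_right mult_zero_right)
  moreover have "u y = 0" if "y \<notin> X" for y using that by (simp add: u_def)
  ultimately show ?thesis by blast
qed

text \<open>
  The squared norms of the residuals of all coordinate vectors add up to
  \<open>card X - card K = 0\<close>, so all residuals vanish.
\<close>

lemma orthonormal_complete:
  assumes "card K = card X" "x \<in> X" "y \<in> X"
  shows "(\<Sum>k\<in>K. cnj (e k x) * e k y) = (if y = x then 1 else 0)"
proof -
  have "(\<Sum>x\<in>X. 1 - (\<Sum>k\<in>K. (cmod (e k x))\<^sup>2)) = 0"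
    using assms(1) sum_norm_residual by simp
  then have "1 - (\<Sum>k\<in>K. (cmod (e k x))\<^sup>2) = 0"
    using sum_nonneg_eq_0_iff[OF fin(1), of "\<lambda>x. 1 - (\<Sum>k\<in>K. (cmod (e k x))\<^sup>2)"]
      norm_residual_nonneg assms(2) by blast
  with cinner_residual_self[OF assms(2)] have "residual e K x y = 0"
    using cinner_self_eq_0_iff[OF fin(1)] assms(3) by simp
  then show ?thesis by (simp add: residual_def indic_def)
qed

end

lemma orthonormal_basis_complete:
  assumes "finite X" "orthonormal_basis X e" "x \<in> X" "y \<in> X"
  shows "(\<Sum>k\<in>X. e k x * cnj (e k y)) = (if x = y then 1 else 0)"
  using orthonormal_complete[of X X e y x] assms
  by (simp add: orthonormal_basis_iff_cinner mult.commute)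

text \<open>
  An eigenvector orthogonal to given ones is found by maximising the quadratic form
  over the unit sphere of their orthogonal complement.
\<close>

lemma exists_orthogonal_eigenvector:
  fixes M :: "'i op"
  assumes fin: "finite X" "finite K" and sa: "self_adjoint X M" and card: "card K < card X"
    and orth: "\<And>j k. j \<in> K \<Longrightarrow> k \<in> K \<Longrightarrow> cinner X (e j) (e k) = (if j = k then 1 else 0)"
    and eig: "\<And>k x. k \<in> K \<Longrightarrow> x \<in> X \<Longrightarrow> op_app X M (e k) x = of_real (l k) * e k x"
  shows "\<exists>u c. cinner X u u = 1 \<and> (\<forall>j\<in>K. cinner X (e j) u = 0) \<and>
    (\<forall>x\<in>X. op_app X M u x = of_real c * u x)"
proof -
  \<comment> \<open>Vectors in \<open>T\<close> vanish outside \<open>X\<close>, so that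
    \<open>T\<close> is a closed part of the compact product \<open>?box\<close> in the product
    topology on all functions.\<close>
  define T where "T = {u. (\<forall>x. x \<notin> X \<longrightarrow> u x = 0) \<and> cinner X u u = 1 \<and> (\<forall>j\<in>K. cinner X (e j) u = 0)}"
  define Q where "Q = (\<lambda>u. Re (cinner X u (op_app X M u)))"
  let ?box = "PiE UNIV (\<lambda>x. if x \<in> X then cball (0::complex) 1 else {0})"
  have "compactin (product_topology (\<lambda>_. euclidean) UNIV) ?box"
    unfolding compactin_PiE by auto
  then have box: "compact ?box" by (simp add: euclidean_product_topology)
  have cont: "continuous_on S (\<lambda>u. u x)" for S and x :: 'i
    by (rule continuous_on_subset[OF continuous_on_product_coordinates]) simp
  have "closed ({u. cinner X u u = 1} \<inter> (\<Inter>j\<in>K. {u. cinner X (e j) u = 0}))"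
    unfolding cinner_def by (intro closed_Int closed_INT ballI closed_Collect_eq continuous_intros cont)
  moreover have "{u. cinner X u u = 1} \<inter> (\<Inter>j\<in>K. {u. cinner X (e j) u = 0}) =
      {u. cinner X u u = 1 \<and> (\<forall>j\<in>K. cinner X (e j) u = 0)}" by auto
  ultimately have clT: "closed {u. cinner X u u = 1 \<and> (\<forall>j\<in>K. cinner X (e j) u = 0)}" by simp
  have "cmod (u x) \<le> 1" if "u \<in> T" "x \<in> X" for u x
  proof -
    have "(\<Sum>x\<in>X. (cmod (u x))\<^sup>2) = 1"
      using that by (simp add: T_def cinner_self_eq_1_iff)
    moreover have "(cmod (u x))\<^sup>2 \<le> (\<Sum>x\<in>X. (cmod (u x))\<^sup>2)"
      using that fin by (intro member_le_sum) auto
    ultimately have "(cmod (u x))\<^sup>2 \<le> 1" by simp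
    then show ?thesis by (simp add: power_le_one_iff)
  qed
  then have "T = ?box \<inter> {u. cinner X u u = 1 \<and> (\<forall>j\<in>K. cinner X (e j) u = 0)}"
    by (auto simp: T_def PiE_def Pi_def extensional_def split: if_splits)
  then have "compact T" using box clT by (simp add: compact_Int_closed)
  moreover have "T \<noteq> {}"
    using exists_orthogonal[OF fin orth card] by (auto simp: T_def)
  moreover have "continuous_on T Q"
    unfolding Q_def cinner_def op_app_def
    by (intro continuous_intros cont)
  ultimately obtain u where u: "u \<in> T" and max: "\<And>w. w \<in> T \<Longrightarrow> Q w \<le> Q u"
    using continuous_attains_sup[of T Q] by auto
  define c where "c = Q u"
  have u1: "cinner X u u = 1" and uK: "\<And>j. j \<in> K \<Longrightarrow> cinner X (e j) u = 0"
    using u by (auto simp: T_def)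
  \<comment> \<open>The quadratic form of c - M. It vanishes at the maximiser \<open>u\<close> and,
    after scaling to unit vectors, is nonnegative on the orthogonal complement of the
    family.\<close>
  define B where "B = (\<lambda>w. c * Re (cinner X w w) - Q w)"
  have Bnonneg: "B w \<ge> 0" if wK: "\<And>j. j \<in> K \<Longrightarrow> cinner X (e j) w = 0" for w
  proof (cases "cinner X w w = 0")
    case True
    then have "\<forall>x\<in>X. w x = 0" using cinner_self_eq_0_iff fin by blast
    then show ?thesis by (simp add: B_def Q_def cinner_def)
  next
    case False
    define n where "n = Re (cinner X w w)"
    have nn: "cinner X w w = of_real n" by (simp add: n_def cinner_self)
    have "n \<ge> 0" by (simp add: n_def cinner_self sum_nonneg)
    with False nn have n: "n > 0" by (cases "n = 0") auto
    define s where "s = 1 / sqrt n"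
    have s2: "s * s = 1 / n" using n by (simp add: s_def)
    define v where "v = (\<lambda>x. if x \<in> X then of_real s * w x else 0)"
    have vv: "cinner X v v = of_real (s * s) * cinner X w w"
      by (subst cinner_cong[of X v "\<lambda>x. of_real s * w x" v "\<lambda>x. of_real s * w x"])
        (auto simp: v_def cinner_mult_left cinner_mult_right)
    have "cinner X v v = 1" using n by (simp add: vv nn s2)
    moreover have "cinner X (e j) v = 0" if "j \<in> K" for j
    proof -
      have "cinner X (e j) v = cinner X (e j) (\<lambda>x. of_real s * w x)"
        by (intro cinner_cong) (auto simp: v_def)
      then show ?thesis using wK[OF that] by (simp add: cinner_mult_right)
    qed
    ultimately have "v \<in> T" by (simp add: T_def v_def)
    then have "Q v \<le> c" using max c_def by simp
    have "op_app X M v = (\<lambda>x. of_real s * op_app X M w x)"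
      by (auto simp: op_app_def v_def sum_distrib_left intro!: ext sum.cong)
    then have "cinner X v (op_app X M v) = cinner X (\<lambda>x. of_real s * w x) (\<lambda>x. of_real s * op_app X M w x)"
      by (intro cinner_cong) (auto simp: v_def)
    also have "\<dots> = of_real (s * s) * cinner X w (op_app X M w)"
      by (simp add: cinner_mult_left cinner_mult_right)
    finally have "Q v = (s * s) * Q w"
      by (simp only: Q_def times_complex.sel Re_complex_of_real Im_complex_of_real mult_zero_left diff_zero)
    with \<open>Q v \<le> c\<close> n show ?thesis
      by (simp add: B_def s2 field_simps flip: n_def)
  qed
  \<comment> \<open>The error in the eigenvalue equation. It is orthogonal to the family because the
    \<open>e j\<close> are eigenvectors, so moving from \<open>u\<close> along \<open>v\<close>
    stays where \<open>B\<close> is nonnegative.\<close>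
  define v where "v = (\<lambda>x. of_real c * u x - op_app X M u x)"
  have vK: "cinner X (e j) v = 0" if "j \<in> K" for j
  proof -
    have "cinner X (e j) (op_app X M u) = cinner X (op_app X M (e j)) u"
      by (simp add: cinner_self_adjoint[OF sa])
    also have "\<dots> = cinner X (\<lambda>x. of_real (l j) * e j x) u"
      using eig that by (intro cinner_cong) auto
    finally show ?thesis
      using uK[OF that] by (simp add: v_def cinner_diff_right cinner_mult_right cinner_mult_left)
  qed
  define n where "n = Re (cinner X v v)"
  have nn: "cinner X v v = of_real n" by (simp add: n_def cinner_self)
  have n0: "n \<ge> 0" by (simp add: n_def cinner_self sum_nonneg)
  have Bexp: "B (\<lambda>x. u x - of_real t * v x) = t * t * B v - 2 * t * n" for t :: real
  proof -
    let ?M = "op_app X M"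
    have app: "?M (\<lambda>x. u x - of_real t * v x) = (\<lambda>x. ?M u x - of_real t * ?M v x)"
      by (simp add: op_app_def sum_subtractf sum_distrib_left algebra_simps)
    have 1: "cinner X v (?M u) = of_real c * cinner X v u - of_real n"
    proof -
      have "cinner X v v = cinner X v (\<lambda>x. of_real c * u x - ?M u x)" by (simp add: v_def)
      then show ?thesis by (simp add: nn cinner_diff_right cinner_mult_right)
    qed
    have 2: "cinner X u (?M v) = cnj (cinner X v (?M u))"
      by (simp add: cinner_cnj cinner_self_adjoint[OF sa])
    have 3: "Re (cinner X u v) = Re (cinner X v u)"
      by (metis cinner_cnj complex_cnj(1) cnj.sel(1))
    have 4: "Re (cinner X u (?M u)) = c" by (simp add: c_def Q_def)
    show ?thesis
      unfolding B_def Q_def app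
      by (simp add: cinner_diff_left cinner_diff_right cinner_mult_left cinner_mult_right 1 2 3 4 u1
          algebra_simps)
  qed
  have "n = 0"
  proof (rule ccontr)
    assume "n \<noteq> 0"
    with n0 have "n > 0" by simp
    define b where "b = B v"
    have "b \<ge> 0" using Bnonneg vK by (simp add: b_def)
    \<comment> \<open>Small enough for the linear term of \<open>Bexp\<close> to win and make
      \<open>B\<close> negative; the \<open>1\<close> covers the case \<open>b = 0\<close>.\<close>
    define t where "t = n / (b + 1)"
    have "t > 0" "t * b < 2 * n" using \<open>n > 0\<close> \<open>b \<ge> 0\<close> by (auto simp: t_def field_simps intro!: add_nonneg_pos mult_nonneg_nonneg)
    then have "t * (t * b - 2 * n) < 0" by (simp add: mult_pos_neg)
    moreover have "B (\<lambda>x. u x - of_real t * v x) \<ge> 0"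
      using uK vK by (intro Bnonneg) (simp add: cinner_diff_right cinner_mult_right)
    ultimately show False
      unfolding Bexp b_def by (simp add: algebra_simps)
  qed
  then have "\<forall>x\<in>X. v x = 0" using cinner_self_eq_0_iff[OF fin(1)] nn by simp
  then have "op_app X M u x = of_real c * u x" if "x \<in> X" for x using that by (simp add: v_def)
  with u1 uK show ?thesis by blast
qed

text \<open>Eigenvectors are added one at a time; since subsets of \<open>X\<close> serve as index
  sets, the process ends at \<open>K = X\<close> with a full basis.\<close>

lemma exists_orthonormal_eigenvectors:
  assumes fin: "finite X" and sa: "self_adjoint X M" and "K \<subseteq> X"
  shows "\<exists>e l. (\<forall>j\<in>K. \<forall>k\<in>K. cinner X (e j) (e k) = (if j = k then 1 else 0)) \<and>
    (\<forall>k\<in>K. \<forall>x\<in>X. op_app X M (e k) x = of_real (l k) * e k x)"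
  using finite_subset[OF assms(3) fin] assms(3)
proof (induction K rule: finite_induct)
  case empty
  then show ?case by simp
next
  case (insert a K)
  then obtain e l where
    orth: "\<And>j k. j \<in> K \<Longrightarrow> k \<in> K \<Longrightarrow> cinner X (e j) (e k) = (if j = k then 1 else 0)" and
    eig: "\<And>k x. k \<in> K \<Longrightarrow> x \<in> X \<Longrightarrow> op_app X M (e k) x = of_real (l k) * e k x"
    by blast
  have "card K < card X"
    using insert fin by (intro psubset_card_mono) auto
  from exists_orthogonal_eigenvector[OF fin insert(1) sa this orth eig] obtain u c where
    u: "cinner X u u = 1" "\<And>j. j \<in> K \<Longrightarrow> cinner X (e j) u = 0"
    "\<And>x. x \<in> X \<Longrightarrow> op_app X M u x = of_real c * u x" by blast
  have u': "cinner X u (e j) = 0" if "j \<in> K" for j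
    using u(2)[OF that] by (metis cinner_cnj complex_cnj_zero)
  have "j \<noteq> a" if "j \<in> K" for j using that insert by auto
  then show ?case
    using u u' orth eig insert(2)
    by (intro exI[of _ "e(a := u)"] exI[of _ "l(a := c)"]) auto
qed

theorem spectral_decomposition:
  assumes "finite X" "self_adjoint X M"
  obtains e l where "orthonormal_basis X e" "\<And>x y. x \<in> X \<Longrightarrow> y \<in> X \<Longrightarrow> M x y = from_spectrum X e l x y"
proof -
  from exists_orthonormal_eigenvectors[OF assms subset_refl] obtain e l where
    onb: "orthonormal_basis X e" and
    eig: "\<And>k x. k \<in> X \<Longrightarrow> x \<in> X \<Longrightarrow> op_app X M (e k) x = of_real (l k) * e k x"
    unfolding orthonormal_basis_iff_cinner by blast
  have "M x y = from_spectrum X e l x y" if "x \<in> X" "y \<in> X" for x y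
  proof -
    have "from_spectrum X e l x y = (\<Sum>k\<in>X. op_app X M (e k) x * cnj (e k y))"
      using eig that by (simp add: from_spectrum_def)
    also have "\<dots> = (\<Sum>k\<in>X. \<Sum>z\<in>X. M x z * (e k z * cnj (e k y)))"
      by (simp add: op_app_def sum_distrib_right mult.assoc)
    also have "\<dots> = (\<Sum>z\<in>X. M x z * (\<Sum>k\<in>X. e k z * cnj (e k y)))"
      by (subst sum.swap) (simp add: sum_distrib_left)
    also have "\<dots> = (\<Sum>z\<in>X. M x z * (if z = y then 1 else 0))"
      using orthonormal_basis_complete[OF assms(1) onb _ that(2)] by simp
    also have "\<dots> = M x y"
      using that assms by (simp add: if_distrib[of "\<lambda>c. _ * c"] cong: if_cong)
    finally show ?thesis by simp
  qed
  with onb that show ?thesis by blast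
qed

section \<open>Monotonicity of relative entropy\<close>

lemma sum_rotate3:
  "(\<Sum>a\<in>A. \<Sum>b\<in>B. \<Sum>c\<in>C. g a b c) = (\<Sum>c\<in>C. \<Sum>a\<in>A. \<Sum>b\<in>B. g a b c)"
proof -
  have "(\<Sum>a\<in>A. \<Sum>b\<in>B. \<Sum>c\<in>C. g a b c) = (\<Sum>a\<in>A. \<Sum>c\<in>C. \<Sum>b\<in>B. g a b c)"
    by (rule sum.cong[OF refl], rule sum.swap)
  also have "\<dots> = (\<Sum>c\<in>C. \<Sum>a\<in>A. \<Sum>b\<in>B. g a b c)" by (rule sum.swap)
  finally show ?thesis .
qed

lemma sum_if_const: "(\<Sum>x\<in>A. if P then f x else 0) = (if P then \<Sum>x\<in>A. f x else 0)"
  by simp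

lemma sum_rotate4:
  "(\<Sum>a\<in>A. \<Sum>b\<in>B. \<Sum>c\<in>C. \<Sum>d\<in>D. g a b c d) = (\<Sum>d\<in>D. \<Sum>a\<in>A. \<Sum>b\<in>B. \<Sum>c\<in>C. g a b c d)"
proof -
  have "(\<Sum>a\<in>A. \<Sum>b\<in>B. \<Sum>c\<in>C. \<Sum>d\<in>D. g a b c d) = (\<Sum>a\<in>A. \<Sum>d\<in>D. \<Sum>b\<in>B. \<Sum>c\<in>C. g a b c d)"
    by (rule sum.cong[OF refl], rule sum_rotate3)
  also have "\<dots> = (\<Sum>d\<in>D. \<Sum>a\<in>A. \<Sum>b\<in>B. \<Sum>c\<in>C. g a b c d)" by (rule sum.swap)
  finally show ?thesis .
qed

lemma sum_exchange_pairs: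
  "(\<Sum>a\<in>A. \<Sum>b\<in>B. \<Sum>c\<in>C. \<Sum>d\<in>D. g a b c d) = (\<Sum>d\<in>D. \<Sum>c\<in>C. \<Sum>a\<in>A. \<Sum>b\<in>B. g a b c d)"
  by (rule trans[OF sum_rotate4], rule sum.cong[OF refl], rule sum_rotate3)

lemma parseval:
  assumes "finite X" "orthonormal_basis X e"
  shows "(\<Sum>k\<in>X. cinner X u (e k) * cinner X (e k) v) = cinner X u v"
proof -
  have "(\<Sum>k\<in>X. cinner X u (e k) * cinner X (e k) v)
      = (\<Sum>k\<in>X. \<Sum>x\<in>X. \<Sum>y\<in>X. cnj (u x) * v y * (e k x * cnj (e k y)))"
    unfolding cinner_def sum_product by (intro sum.cong refl) (simp add: mult_ac)
  also have "\<dots> = (\<Sum>x\<in>X. \<Sum>y\<in>X. cnj (u x) * v y * (\<Sum>k\<in>X. e k x * cnj (e k y)))"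
    by (subst sum_rotate3[symmetric]) (simp add: sum_distrib_left)
  also have "\<dots> = (\<Sum>x\<in>X. \<Sum>y\<in>X. if x = y then cnj (u x) * v y else 0)"
    using assms by (intro sum.cong refl) (simp add: orthonormal_basis_complete)
  also have "\<dots> = cinner X u v"
    using assms by (simp add: cinner_def)
  finally show ?thesis .
qed

lemma parseval_norm:
  assumes "finite X" "orthonormal_basis X e"
  shows "(\<Sum>k\<in>X. (cmod (cinner X (e k) u))\<^sup>2) = Re (cinner X u u)"
proof -
  have "(\<Sum>k\<in>X. cinner X u (e k) * cinner X (e k) u) = of_real (\<Sum>k\<in>X. (cmod (cinner X (e k) u))\<^sup>2)"
    unfolding of_real_sum
    by (intro sum.cong refl) (metis cinner_cnj complex_norm_square mult.commute)
  with parseval[OF assms, of u u] show ?thesis by (metis Re_complex_of_real)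
qed

lemma Re_sum_of_real_mult: "Re (\<Sum>j\<in>A. of_real (q j) * z j) = (\<Sum>j\<in>A. q j * Re (z j))"
  by simp

text \<open>This sum and those of the next two lemmas are Tr(N' rho), Tr(N rho N') and Tr(N' sigma
  N), with N' the adjoint of \<open>N\<close>: the three terms of the variational expression,
  expressed through eigenvectors.\<close>

lemma sum_from_spectrum_left:
  "(\<Sum>s\<in>X. \<Sum>t\<in>X. cnj (N s t) * from_spectrum X e p s t)
     = (\<Sum>i\<in>X. of_real (p i) * cinner X (op_app X N (e i)) (e i))"
proof -
  have "(\<Sum>s\<in>X. \<Sum>t\<in>X. cnj (N s t) * from_spectrum X e p s t)
      = (\<Sum>s\<in>X. \<Sum>t\<in>X. \<Sum>i\<in>X. of_real (p i) * (cnj (N s t) * cnj (e i t) * e i s))"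
    unfolding from_spectrum_def sum_distrib_left by (intro sum.cong refl) (simp add: mult_ac)
  also have "\<dots> = (\<Sum>i\<in>X. \<Sum>s\<in>X. \<Sum>t\<in>X. of_real (p i) * (cnj (N s t) * cnj (e i t) * e i s))"
    by (rule sum_rotate3)
  finally show ?thesis
    by (simp add: cinner_def op_app_def sum_distrib_left sum_distrib_right)
qed

lemma sum_from_spectrum_right:
  "(\<Sum>s\<in>X. \<Sum>t\<in>X. \<Sum>t'\<in>X. N s t * from_spectrum X e p t t' * cnj (N s t'))
     = (\<Sum>i\<in>X. of_real (p i) * cinner X (op_app X N (e i)) (op_app X N (e i)))"
proof -
  have "(\<Sum>s\<in>X. \<Sum>t\<in>X. \<Sum>t'\<in>X. N s t * from_spectrum X e p t t' * cnj (N s t'))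
      = (\<Sum>s\<in>X. \<Sum>t\<in>X. \<Sum>t'\<in>X. \<Sum>i\<in>X. of_real (p i) * ((N s t * e i t) * (cnj (N s t') * cnj (e i t'))))"
    unfolding from_spectrum_def sum_distrib_left sum_distrib_right
    by (intro sum.cong refl) (simp add: mult_ac)
  also have "\<dots> = (\<Sum>i\<in>X. \<Sum>s\<in>X. \<Sum>t\<in>X. \<Sum>t'\<in>X. of_real (p i) * ((N s t * e i t) * (cnj (N s t') * cnj (e i t'))))"
    by (rule sum_rotate4)
  also have "\<dots> = (\<Sum>i\<in>X. of_real (p i) * (\<Sum>s\<in>X. op_app X N (e i) s * cnj (op_app X N (e i) s)))"
    unfolding op_app_def cnj_sum sum_product unfolding sum_distrib_left by simp
  finally show ?thesis
    by (simp add: cinner_def mult.commute)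
qed

lemma sum_from_spectrum_middle:
  "(\<Sum>s\<in>X. \<Sum>s'\<in>X. \<Sum>t\<in>X. cnj (N s t) * from_spectrum X f q s s' * N s' t)
     = (\<Sum>j\<in>X. of_real (q j) * (\<Sum>t\<in>X. cinner X (\<lambda>s. N s t) (f j) * cinner X (f j) (\<lambda>s. N s t)))"
proof -
  have "(\<Sum>s\<in>X. \<Sum>s'\<in>X. \<Sum>t\<in>X. cnj (N s t) * from_spectrum X f q s s' * N s' t)
      = (\<Sum>s\<in>X. \<Sum>s'\<in>X. \<Sum>t\<in>X. \<Sum>j\<in>X. of_real (q j) * ((cnj (N s t) * f j s) * (cnj (f j s') * N s' t)))"
    unfolding from_spectrum_def sum_distrib_left sum_distrib_right
    by (intro sum.cong refl) (simp add: mult_ac)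
  also have "\<dots> = (\<Sum>j\<in>X. \<Sum>t\<in>X. \<Sum>s\<in>X. \<Sum>s'\<in>X. of_real (q j) * ((cnj (N s t) * f j s) * (cnj (f j s') * N s' t)))"
    by (rule sum_exchange_pairs)
  finally show ?thesis
    unfolding cinner_def sum_product unfolding sum_distrib_left .
qed

lemma trace_from_spectrum:
  "(\<Sum>s\<in>X. \<Sum>t\<in>X. from_spectrum X e p s t * from_spectrum X f m t s)
     = of_real (\<Sum>j\<in>X. \<Sum>i\<in>X. (cmod (cinner X (f j) (e i)))\<^sup>2 * p i * m j)"
proof -
  have "(\<Sum>s\<in>X. \<Sum>t\<in>X. from_spectrum X e p s t * from_spectrum X f m t s)
      = (\<Sum>s\<in>X. \<Sum>t\<in>X. \<Sum>i\<in>X. \<Sum>j\<in>X. of_real (p i * m j) * ((cnj (f j s) * e i s) * (cnj (e i t) * f j t)))"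
    unfolding from_spectrum_def sum_product by (intro sum.cong refl) (simp add: mult_ac)
  also have "\<dots> = (\<Sum>j\<in>X. \<Sum>i\<in>X. \<Sum>s\<in>X. \<Sum>t\<in>X. of_real (p i * m j) * ((cnj (f j s) * e i s) * (cnj (e i t) * f j t)))"
    by (rule sum_exchange_pairs)
  also have "\<dots> = (\<Sum>j\<in>X. \<Sum>i\<in>X. of_real (p i * m j) * (cinner X (f j) (e i) * cinner X (e i) (f j)))"
    unfolding cinner_def sum_product unfolding sum_distrib_left ..
  also have "\<dots> = of_real (\<Sum>j\<in>X. \<Sum>i\<in>X. (cmod (cinner X (f j) (e i)))\<^sup>2 * p i * m j)"
    unfolding of_real_sum
  proof (intro sum.cong refl)
    fix j i
    have "cinner X (f j) (e i) * cinner X (e i) (f j) = of_real ((cmod (cinner X (f j) (e i)))\<^sup>2)"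
      by (metis cinner_cnj complex_norm_square)
    then show "of_real (p i * m j) * (cinner X (f j) (e i) * cinner X (e i) (f j))
        = complex_of_real ((cmod (cinner X (f j) (e i)))\<^sup>2 * p i * m j)"
      by (simp only: of_real_mult mult_ac)
  qed
  finally show ?thesis .
qed

text \<open>
  For positive operators, the maximum over all \<open>N\<close> is the value at \<open>\<rho>\<close> of the quadratic form
  inverse to \<open>N \<mapsto> a \<sigma> N + b N \<rho>\<close>. Being a maximum of expressions that are
  compatible with tensoring \<open>N\<close> with the identity, it can only decrease under partial traces.
\<close>

definition variational :: "'i set \<Rightarrow> 'i op \<Rightarrow> 'i op \<Rightarrow> real \<Rightarrow> real \<Rightarrow> 'i op \<Rightarrow> real" where
  "variational X \<rho> \<sigma> a b N =
     2 * Re (\<Sum>s\<in>X. \<Sum>t\<in>X. cnj (N s t) * \<rho> s t)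
     - a * Re (\<Sum>s\<in>X. \<Sum>s'\<in>X. \<Sum>t\<in>X. cnj (N s t) * \<sigma> s s' * N s' t)
     - b * Re (\<Sum>s\<in>X. \<Sum>t\<in>X. \<Sum>t'\<in>X. N s t * \<rho> t t' * cnj (N s t'))"

definition overlap :: "'i set \<Rightarrow> ('i \<Rightarrow> 'i \<Rightarrow> complex) \<Rightarrow> ('i \<Rightarrow> 'i \<Rightarrow> complex) \<Rightarrow> 'i \<Rightarrow> 'i \<Rightarrow> real" where
  "overlap X f e j i = (cmod (cinner X (f j) (e i)))\<^sup>2"

text \<open>The value <rho, K^-1 rho> for K N = a sigma N + b N rho: in the basis f_j e_i^dagger,
  rho has the coordinates p_i <f_j, e_i> and K has the eigenvalues a q_j + b p_i.\<close>

definition inverse_form ::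
    "'i set \<Rightarrow> ('i \<Rightarrow> 'i \<Rightarrow> complex) \<Rightarrow> ('i \<Rightarrow> real) \<Rightarrow> ('i \<Rightarrow> 'i \<Rightarrow> complex) \<Rightarrow> ('i \<Rightarrow> real) \<Rightarrow> real \<Rightarrow> real \<Rightarrow> real" where
  "inverse_form X e p f q a b =
     (\<Sum>j\<in>X. \<Sum>i\<in>X. overlap X f e j i * (p i)\<^sup>2 / (a * q j + b * p i))"

text \<open>In the coordinates \<open>n j i\<close> both quadratic terms are diagonal, so the
  maximisation over \<open>N\<close> splits into one scalar problem for each pair.\<close>

lemma variational_spectral:
  fixes X :: "'i set" and N :: "'i op"
  assumes "finite X" "orthonormal_basis X e" "orthonormal_basis X f"
  defines "n \<equiv> \<lambda>j i. cinner X (f j) (op_app X N (e i))"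
  shows "variational X (from_spectrum X e p) (from_spectrum X f q) a b N =
    (\<Sum>j\<in>X. \<Sum>i\<in>X. 2 * p i * Re (cnj (n j i) * cinner X (f j) (e i))
       - (a * q j + b * p i) * (cmod (n j i))\<^sup>2)"
proof -
  have 1: "Re (\<Sum>s\<in>X. \<Sum>t\<in>X. cnj (N s t) * from_spectrum X e p s t)
      = (\<Sum>j\<in>X. \<Sum>i\<in>X. p i * Re (cnj (n j i) * cinner X (f j) (e i)))"
  proof -
    have "Re (\<Sum>s\<in>X. \<Sum>t\<in>X. cnj (N s t) * from_spectrum X e p s t)
        = (\<Sum>i\<in>X. p i * Re (cinner X (op_app X N (e i)) (e i)))"
      by (simp add: sum_from_spectrum_left)
    also have "\<dots> = (\<Sum>i\<in>X. \<Sum>j\<in>X. p i * Re (cnj (n j i) * cinner X (f j) (e i)))"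
      unfolding n_def cinner_cnj
      by (subst parseval[OF assms(1,3), symmetric]) (simp add: sum_distrib_left)
    finally show ?thesis by (subst sum.swap)
  qed
  have 2: "Re (\<Sum>s\<in>X. \<Sum>t\<in>X. \<Sum>t'\<in>X. N s t * from_spectrum X e p t t' * cnj (N s t'))
      = (\<Sum>j\<in>X. \<Sum>i\<in>X. p i * (cmod (n j i))\<^sup>2)"
  proof -
    have "Re (\<Sum>s\<in>X. \<Sum>t\<in>X. \<Sum>t'\<in>X. N s t * from_spectrum X e p t t' * cnj (N s t'))
        = (\<Sum>i\<in>X. p i * Re (cinner X (op_app X N (e i)) (op_app X N (e i))))"
      by (simp add: sum_from_spectrum_right)
    also have "\<dots> = (\<Sum>i\<in>X. \<Sum>j\<in>X. p i * (cmod (n j i))\<^sup>2)"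
      unfolding n_def by (simp add: parseval_norm[OF assms(1,3), symmetric] sum_distrib_left)
    finally show ?thesis by (subst sum.swap)
  qed
  have 3: "Re (\<Sum>s\<in>X. \<Sum>s'\<in>X. \<Sum>t\<in>X. cnj (N s t) * from_spectrum X f q s s' * N s' t)
      = (\<Sum>j\<in>X. \<Sum>i\<in>X. q j * (cmod (n j i))\<^sup>2)"
  proof -
    have "Re (\<Sum>t\<in>X. cinner X (\<lambda>s. N s t) (f j) * cinner X (f j) (\<lambda>s. N s t)) = (\<Sum>i\<in>X. (cmod (n j i))\<^sup>2)" for j
    proof -
      \<comment> \<open>The adjoint of \<open>N\<close> applied to \<open>f j\<close>; its
        coordinates in the basis \<open>e\<close> are the conjugates of
        \<open>n j i\<close>.\<close>
      define u where "u = (\<lambda>t. cinner X (\<lambda>s. N s t) (f j))"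
      have "cinner X u (e i) = n j i" for i
      proof -
        have "cinner X u (e i) = (\<Sum>t\<in>X. \<Sum>s\<in>X. cnj (f j s) * (N s t * e i t))"
          unfolding u_def cinner_def cnj_sum sum_distrib_right by (intro sum.cong refl) simp
        also have "\<dots> = n j i"
          by (subst sum.swap) (simp add: n_def cinner_def op_app_def sum_distrib_left)
        finally show ?thesis .
      qed
      then have "cmod (cinner X (e i) u) = cmod (n j i)" for i
        by (metis cinner_cnj complex_mod_cnj)
      then have "(\<Sum>i\<in>X. (cmod (n j i))\<^sup>2) = Re (cinner X u u)"
        using parseval_norm[OF assms(1,2), of u] by simp
      also have "cinner X u u = (\<Sum>t\<in>X. cinner X (\<lambda>s. N s t) (f j) * cinner X (f j) (\<lambda>s. N s t))"
        unfolding cinner_def[of X u u] by (simp add: u_def cinner_cnj mult.commute)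
      finally show ?thesis by simp
    qed
    then show ?thesis
      unfolding sum_from_spectrum_middle Re_sum_of_real_mult by (simp only: sum_distrib_left)
  qed
  show ?thesis
    unfolding variational_def 1 2 3
    by (simp add: sum_subtractf sum.distrib sum_distrib_left algebra_simps)
qed

lemma variational_le:
  assumes "finite X" "orthonormal_basis X e" "orthonormal_basis X f"
    and pos: "\<And>i j. i \<in> X \<Longrightarrow> j \<in> X \<Longrightarrow> a * q j + b * p i > 0"
  shows "variational X (from_spectrum X e p) (from_spectrum X f q) a b N \<le> inverse_form X e p f q a b"
proof -
  \<comment> \<open>Completing the square: after bounding the real part by |n| |c|, what remains is
    (k |n| - |x| |c|)^2 >= 0.\<close>
  have *: "2 * x * Re (cnj n * c) - k * (cmod n)\<^sup>2 \<le> (cmod c)\<^sup>2 * x\<^sup>2 / k" if "k > 0" for x k :: real and n c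
  proof -
    have "x * Re (cnj n * c) \<le> \<bar>x * Re (cnj n * c)\<bar>" by simp
    also have "\<dots> \<le> \<bar>x\<bar> * (cmod n * cmod c)"
      unfolding abs_mult using abs_Re_le_cmod[of "cnj n * c"]
      by (intro mult_left_mono) (auto simp: norm_mult)
    finally have "2 * x * Re (cnj n * c) - k * (cmod n)\<^sup>2 \<le> 2 * (\<bar>x\<bar> * (cmod n * cmod c)) - k * (cmod n)\<^sup>2"
      by simp
    also have "\<dots> \<le> (cmod c)\<^sup>2 * x\<^sup>2 / k"
    proof -
      have "0 \<le> (k * cmod n - \<bar>x\<bar> * cmod c)\<^sup>2" by simp
      then have "k * (2 * (\<bar>x\<bar> * (cmod n * cmod c)) - k * (cmod n)\<^sup>2) \<le> (cmod c)\<^sup>2 * x\<^sup>2"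
        by (simp add: power2_eq_square algebra_simps)
      with that show ?thesis by (simp add: pos_le_divide_eq mult.commute)
    qed
    finally show ?thesis .
  qed
  show ?thesis
    unfolding variational_spectral[OF assms(1-3)] inverse_form_def overlap_def
    using pos by (intro sum_mono *) auto
qed

lemma variational_attained:
  assumes "finite X" "orthonormal_basis X e" "orthonormal_basis X f"
    and pos: "\<And>i j. i \<in> X \<Longrightarrow> j \<in> X \<Longrightarrow> a * q j + b * p i > 0"
  shows "\<exists>N. variational X (from_spectrum X e p) (from_spectrum X f q) a b N = inverse_form X e p f q a b"
proof -
  \<comment> \<open>The maximiser of each scalar problem; the operator \<open>N\<close> with these
    coordinates is K^-1 rho.\<close>
  define n where "n = (\<lambda>j i. of_real (p i / (a * q j + b * p i)) * cinner X (f j) (e i))"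
  define N where "N = (\<lambda>s t. \<Sum>j\<in>X. \<Sum>k\<in>X. n j k * f j s * cnj (e k t))"
  have n: "cinner X (f j) (op_app X N (e i)) = n j i" if "j \<in> X" "i \<in> X" for i j
  proof -
    have "op_app X N (e i) s = (\<Sum>j\<in>X. n j i * f j s)" for s
    proof -
      have "op_app X N (e i) s = (\<Sum>t\<in>X. \<Sum>j\<in>X. \<Sum>k\<in>X. n j k * f j s * (cnj (e k t) * e i t))"
        by (simp add: op_app_def N_def sum_distrib_right mult.assoc)
      also have "\<dots> = (\<Sum>j\<in>X. \<Sum>k\<in>X. n j k * f j s * cinner X (e k) (e i))"
        by (subst sum_rotate3[symmetric]) (simp add: cinner_def sum_distrib_left)
      also have "\<dots> = (\<Sum>j\<in>X. \<Sum>k\<in>X. if k = i then n j k * f j s else 0)"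
        using assms(2) that by (intro sum.cong refl) (auto simp: orthonormal_basis_iff_cinner)
      finally show ?thesis using assms(1) that by simp
    qed
    then have "op_app X N (e i) = (\<lambda>s. \<Sum>j\<in>X. n j i * f j s)" by (rule ext)
    then have "cinner X (f j) (op_app X N (e i)) = (\<Sum>k\<in>X. n k i * cinner X (f j) (f k))"
      by (simp add: cinner_sum_right cinner_mult_right)
    also have "\<dots> = (\<Sum>k\<in>X. if k = j then n k i else 0)"
      using assms(3) that by (intro sum.cong refl) (auto simp: orthonormal_basis_iff_cinner)
    finally show ?thesis using assms(1) that by simp
  qed
  have *: "2 * x * Re (cnj (of_real (x / k) * c) * c) - k * (cmod (of_real (x / k) * c))\<^sup>2 = (cmod c)\<^sup>2 * x\<^sup>2 / k"
    if "k > 0" for x k :: real and c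
  proof -
    have "cnj (of_real (x / k) * c) * c = of_real (x / k * (cmod c)\<^sup>2)"
      unfolding of_real_mult complex_norm_square by simp
    then have "Re (cnj (of_real (x / k) * c) * c) = x / k * (cmod c)\<^sup>2"
      by (simp only: Re_complex_of_real)
    moreover have "(cmod (of_real (x / k) * c))\<^sup>2 = (x / k)\<^sup>2 * (cmod c)\<^sup>2"
      by (simp only: norm_mult norm_of_real power_mult_distrib power2_abs)
    ultimately show ?thesis using that by (simp add: field_simps power2_eq_square)
  qed
  show ?thesis
    unfolding variational_spectral[OF assms(1-3)] inverse_form_def overlap_def
    using pos * by (intro exI[of _ N] sum.cong refl) (simp only: n, simp only: n_def)
qed

lemma variational_cong:
  assumes "\<And>x y. x \<in> X \<Longrightarrow> y \<in> X \<Longrightarrow> \<rho> x y = \<rho>' x y" "\<And>x y. x \<in> X \<Longrightarrow> y \<in> X \<Longrightarrow> \<sigma> x y = \<sigma>' x y"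
  shows "variational X \<rho> \<sigma> a b N = variational X \<rho>' \<sigma>' a b N"
  using assms by (simp add: variational_def)

text \<open>The test operator is N tensor 1. Its Kronecker delta forces equal
  \<open>Y\<close>-indices, so \<open>\<rho>\<close> and \<open>\<sigma>\<close> enter only through
  their partial traces.\<close>

lemma variational_tensor:
  assumes fin: "finite X" "finite Y"
    and \<rho>: "\<And>x x'. x \<in> X \<Longrightarrow> x' \<in> X \<Longrightarrow> \<rho>X x x' = (\<Sum>y\<in>Y. \<rho> (x, y) (x', y))"
    and \<sigma>: "\<And>x x'. x \<in> X \<Longrightarrow> x' \<in> X \<Longrightarrow> \<sigma>X x x' = (\<Sum>y\<in>Y. \<sigma> (x, y) (x', y))"
  shows "variational (X \<times> Y) \<rho> \<sigma> a b (\<lambda>(x, y) (x', y'). if y = y' then N x x' else 0)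
    = variational X \<rho>X \<sigma>X a b N"
proof -
  let ?N = "\<lambda>(x, y) (x', y'). if y = y' then N x x' else 0"
  have 1: "(\<Sum>s\<in>X\<times>Y. \<Sum>t\<in>X\<times>Y. cnj (?N s t) * \<rho> s t) = (\<Sum>x\<in>X. \<Sum>x'\<in>X. cnj (N x x') * \<rho>X x x')"
  proof -
    have "(\<Sum>s\<in>X\<times>Y. \<Sum>t\<in>X\<times>Y. cnj (?N s t) * \<rho> s t)
        = (\<Sum>x\<in>X. \<Sum>y\<in>Y. \<Sum>x'\<in>X. \<Sum>y'\<in>Y. if y = y' then cnj (N x x') * \<rho> (x, y) (x', y') else 0)"
      unfolding sum.cartesian_product' by (intro sum.cong refl) auto
    also have "\<dots> = (\<Sum>x\<in>X. \<Sum>y\<in>Y. \<Sum>x'\<in>X. cnj (N x x') * \<rho> (x, y) (x', y))"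
      using fin by (simp cong: sum.cong)
    also have "\<dots> = (\<Sum>x\<in>X. \<Sum>x'\<in>X. \<Sum>y\<in>Y. cnj (N x x') * \<rho> (x, y) (x', y))"
      by (rule sum.cong[OF refl], rule sum.swap)
    finally show ?thesis using \<rho> by (simp add: sum_distrib_left)
  qed
  have 2: "(\<Sum>s\<in>X\<times>Y. \<Sum>s'\<in>X\<times>Y. \<Sum>t\<in>X\<times>Y. cnj (?N s t) * \<sigma> s s' * ?N s' t)
      = (\<Sum>s\<in>X. \<Sum>s'\<in>X. \<Sum>t\<in>X. cnj (N s t) * \<sigma>X s s' * N s' t)"
  proof -
    \<comment> \<open>Nested conditionals let each redundant sum over \<open>Y\<close> collapse on
      its own.\<close>
    have "(\<Sum>s\<in>X\<times>Y. \<Sum>s'\<in>X\<times>Y. \<Sum>t\<in>X\<times>Y. cnj (?N s t) * \<sigma> s s' * ?N s' t)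
        = (\<Sum>x\<in>X. \<Sum>y\<in>Y. \<Sum>x'\<in>X. \<Sum>y'\<in>Y. \<Sum>x''\<in>X. \<Sum>y''\<in>Y.
             if y'' = y then if y' = y then cnj (N x x'') * \<sigma> (x, y) (x', y') * N x' x'' else 0 else 0)"
      unfolding sum.cartesian_product' by (intro sum.cong refl) auto
    also have "\<dots> = (\<Sum>x\<in>X. \<Sum>y\<in>Y. \<Sum>x'\<in>X. \<Sum>x''\<in>X. cnj (N x x'') * \<sigma> (x, y) (x', y) * N x' x'')"
      using fin by (simp add: sum_if_const cong: sum.cong)
    also have "\<dots> = (\<Sum>x\<in>X. \<Sum>x'\<in>X. \<Sum>x''\<in>X. \<Sum>y\<in>Y. cnj (N x x'') * \<sigma> (x, y) (x', y) * N x' x'')"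
      by (rule sum.cong[OF refl], rule sum_rotate3[symmetric])
    finally show ?thesis using \<sigma> by (simp add: sum_distrib_left sum_distrib_right)
  qed
  have 3: "(\<Sum>s\<in>X\<times>Y. \<Sum>t\<in>X\<times>Y. \<Sum>t'\<in>X\<times>Y. ?N s t * \<rho> t t' * cnj (?N s t'))
      = (\<Sum>s\<in>X. \<Sum>t\<in>X. \<Sum>t'\<in>X. N s t * \<rho>X t t' * cnj (N s t'))"
  proof -
    have "(\<Sum>s\<in>X\<times>Y. \<Sum>t\<in>X\<times>Y. \<Sum>t'\<in>X\<times>Y. ?N s t * \<rho> t t' * cnj (?N s t'))
        = (\<Sum>x\<in>X. \<Sum>y\<in>Y. \<Sum>x'\<in>X. \<Sum>y'\<in>Y. \<Sum>x''\<in>X. \<Sum>y''\<in>Y.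
             if y'' = y then if y' = y then N x x' * \<rho> (x', y') (x'', y'') * cnj (N x x'') else 0 else 0)"
      unfolding sum.cartesian_product' by (intro sum.cong refl) auto
    also have "\<dots> = (\<Sum>x\<in>X. \<Sum>y\<in>Y. \<Sum>x'\<in>X. \<Sum>x''\<in>X. N x x' * \<rho> (x', y) (x'', y) * cnj (N x x''))"
      using fin by (simp add: sum_if_const cong: sum.cong)
    also have "\<dots> = (\<Sum>x\<in>X. \<Sum>x'\<in>X. \<Sum>x''\<in>X. \<Sum>y\<in>Y. N x x' * \<rho> (x', y) (x'', y) * cnj (N x x''))"
      by (rule sum.cong[OF refl], rule sum_rotate3[symmetric])
    finally show ?thesis using \<rho> by (simp add: sum_distrib_left sum_distrib_right)
  qed
  show ?thesis unfolding variational_def 1 2 3 ..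
qed

section \<open>Interpolation between the logarithms\<close>

text \<open>The eigenbasis is a parameter, so that a basis chosen by \<open>op_log\<close>, a
  product basis and a relabelled one can all be used. Strict positivity keeps every
  \<open>ln\<close> and every denominator meaningful.\<close>

definition pos_spectral :: "'i set \<Rightarrow> 'i op \<Rightarrow> ('i \<Rightarrow> 'i \<Rightarrow> complex) \<Rightarrow> ('i \<Rightarrow> real) \<Rightarrow> bool" where
  "pos_spectral X M e p \<longleftrightarrow> orthonormal_basis X e \<and>
     (\<forall>x\<in>X. \<forall>y\<in>X. M x y = from_spectrum X e p x y) \<and> (\<forall>k\<in>X. 0 < p k)"

lemma trace_from_spectrum_self:
  assumes "orthonormal_basis X e"
  shows "(\<Sum>x\<in>X. from_spectrum X e p x x) = of_real (\<Sum>k\<in>X. p k)"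
proof -
  have "(\<Sum>x\<in>X. from_spectrum X e p x x) = (\<Sum>k\<in>X. \<Sum>x\<in>X. of_real (p k) * (cnj (e k x) * e k x))"
    unfolding from_spectrum_def by (subst sum.swap) (simp add: mult_ac)
  also have "\<dots> = (\<Sum>k\<in>X. of_real (p k) * cinner X (e k) (e k))"
    by (simp add: cinner_def sum_distrib_left)
  finally show ?thesis using assms by (simp add: orthonormal_basis_iff_cinner)
qed

lemma trace_from_spectrum_same:
  assumes "finite X" "orthonormal_basis X e"
  shows "(\<Sum>s\<in>X. \<Sum>t\<in>X. from_spectrum X e p s t * from_spectrum X e m t s) = of_real (\<Sum>k\<in>X. p k * m k)"
proof -
  have "(\<Sum>j\<in>X. \<Sum>i\<in>X. (cmod (cinner X (e j) (e i)))\<^sup>2 * p i * m j)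
      = (\<Sum>j\<in>X. \<Sum>i\<in>X. if i = j then p i * m j else 0)"
    using assms(2) by (intro sum.cong refl) (auto simp: orthonormal_basis_iff_cinner)
  then show ?thesis
    using assms(1) unfolding trace_from_spectrum by simp
qed

lemma sum_overlap:
  assumes "finite X" "orthonormal_basis X e" "orthonormal_basis X f" "i \<in> X"
  shows "(\<Sum>j\<in>X. overlap X f e j i) = 1"
  using parseval_norm[OF assms(1,3), of "e i"] assms(2,4)
  by (simp add: overlap_def orthonormal_basis_iff_cinner)

text \<open>Interpolates between \<open>Tr (\<rho> log \<sigma>)\<close> at \<open>s = 0\<close> and \<open>Tr (\<rho> log \<rho>)\<close> at \<open>s = 1\<close>.\<close>

definition log_interpolation ::
    "'i set \<Rightarrow> ('i \<Rightarrow> 'i \<Rightarrow> complex) \<Rightarrow> ('i \<Rightarrow> real) \<Rightarrow> ('i \<Rightarrow> 'i \<Rightarrow> complex) \<Rightarrow> ('i \<Rightarrow> real) \<Rightarrow> real \<Rightarrow> real" where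
  "log_interpolation X e p f q s =
     (\<Sum>j\<in>X. \<Sum>i\<in>X. overlap X f e j i * p i * ln ((1 - s) * q j + s * p i))"

lemma log_interpolation_0:
  "log_interpolation X e p f q 0
    = Re (\<Sum>s\<in>X. \<Sum>t\<in>X. from_spectrum X e p s t * from_spectrum X f (\<lambda>k. ln (q k)) t s)"
  unfolding trace_from_spectrum Re_complex_of_real log_interpolation_def overlap_def by simp

lemma log_interpolation_1:
  assumes "finite X" "orthonormal_basis X e" "orthonormal_basis X f"
  shows "log_interpolation X e p f q 1 = (\<Sum>i\<in>X. p i * ln (p i))"
proof -
  have "log_interpolation X e p f q 1 = (\<Sum>i\<in>X. (\<Sum>j\<in>X. overlap X f e j i) * (p i * ln (p i)))"
    unfolding log_interpolation_def by (subst sum.swap) (simp add: sum_distrib_right mult.assoc)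
  then show ?thesis using assms by (simp add: sum_overlap)
qed

lemma convex_pos:
  fixes x y s :: real
  assumes "0 < x" "0 < y" "0 \<le> s" "s \<le> 1"
  shows "0 < (1 - s) * x + s * y"
  using assms by (cases "s = 0") (auto intro!: add_nonneg_pos)

lemma continuous_on_log_interpolation:
  assumes "\<And>i. i \<in> X \<Longrightarrow> 0 < p i" "\<And>i. i \<in> X \<Longrightarrow> 0 < q i"
  shows "continuous_on {0..1} (log_interpolation X e p f q)"
proof -
  have "(1 - s) * q j + s * p i \<noteq> 0" if "s \<in> {0..1}" "i \<in> X" "j \<in> X" for s i j
    using convex_pos[of "q j" "p i" s] assms that by auto
  then show ?thesis
    unfolding log_interpolation_def by (intro continuous_intros) auto
qed

text \<open>With k = (1 - s) q_j + s p_i one has p_i - k = (1 - s) (p_i - q_j), hence (p_i - q_j) /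
  k = (p_i / k - 1) / (1 - s). The subtracted part sums to Tr rho because the overlaps add up to 1
  over \<open>j\<close>.\<close>

lemma DERIV_log_interpolation:
  assumes fin: "finite X" and onb: "orthonormal_basis X e" "orthonormal_basis X f"
    and pos: "\<And>i. i \<in> X \<Longrightarrow> 0 < p i" "\<And>i. i \<in> X \<Longrightarrow> 0 < q i" and s: "0 < s" "s < 1"
  shows "(log_interpolation X e p f q has_real_derivative
    (inverse_form X e p f q (1 - s) s - (\<Sum>i\<in>X. p i)) / (1 - s)) (at s)"
proof -
  have k: "(1 - s) * q j + s * p i > 0" if "i \<in> X" "j \<in> X" for i j
    using convex_pos[of "q j" "p i" s] pos that s by simp
  have "(log_interpolation X e p f q has_real_derivative
     (\<Sum>j\<in>X. \<Sum>i\<in>X. overlap X f e j i * p i * ((p i - q j) / ((1 - s) * q j + s * p i)))) (at s)"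
    unfolding log_interpolation_def
    using k by (intro DERIV_sum) (auto intro!: derivative_eq_intros)
  also have "(\<Sum>j\<in>X. \<Sum>i\<in>X. overlap X f e j i * p i * ((p i - q j) / ((1 - s) * q j + s * p i)))
     = (\<Sum>j\<in>X. \<Sum>i\<in>X. (overlap X f e j i * (p i)\<^sup>2 / ((1 - s) * q j + s * p i) - overlap X f e j i * p i) / (1 - s))"
  proof (intro sum.cong refl)
    fix i j assume "j \<in> X" "i \<in> X"
    then have nz: "(1 - s) * q j + s * p i \<noteq> 0" using k by force
    then have "(p i - q j) / ((1 - s) * q j + s * p i) = (p i / ((1 - s) * q j + s * p i) - 1) / (1 - s)"
      using s by (simp add: divide_simps) (simp add: algebra_simps)
    then show "overlap X f e j i * p i * ((p i - q j) / ((1 - s) * q j + s * p i))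
      = (overlap X f e j i * (p i)\<^sup>2 / ((1 - s) * q j + s * p i) - overlap X f e j i * p i) / (1 - s)"
      by (simp add: power2_eq_square algebra_simps)
  qed
  also have "\<dots> = (inverse_form X e p f q (1 - s) s - (\<Sum>j\<in>X. \<Sum>i\<in>X. overlap X f e j i * p i)) / (1 - s)"
    by (simp add: inverse_form_def sum_subtractf flip: sum_divide_distrib)
  also have "(\<Sum>j\<in>X. \<Sum>i\<in>X. overlap X f e j i * p i) = (\<Sum>i\<in>X. p i)"
    by (subst sum.swap) (simp add: sum_overlap[OF fin onb] flip: sum_distrib_right)
  finally show ?thesis .
qed

text \<open>The optimal \<open>N\<close> on \<open>X\<close>, tensored with the identity, is one
  competitor for the maximum on \<open>X \<times> Y\<close>, so the inverse forms compare. As the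
  traces agree, the difference \<open>D\<close> of the two interpolations is increasing.\<close>

theorem relative_entropy_partial_trace_le:
  assumes fin: "finite X" "finite Y"
    and \<rho>: "pos_spectral (X \<times> Y) \<rho> e p" and \<sigma>: "pos_spectral (X \<times> Y) \<sigma> f q"
    and \<rho>X: "pos_spectral X \<rho>X g r" and \<sigma>X: "pos_spectral X \<sigma>X h w"
    and trace_\<rho>: "\<And>x x'. x \<in> X \<Longrightarrow> x' \<in> X \<Longrightarrow> \<rho>X x x' = (\<Sum>y\<in>Y. \<rho> (x, y) (x', y))"
    and trace_\<sigma>: "\<And>x x'. x \<in> X \<Longrightarrow> x' \<in> X \<Longrightarrow> \<sigma>X x x' = (\<Sum>y\<in>Y. \<sigma> (x, y) (x', y))"
  shows "(\<Sum>i\<in>X. r i * ln (r i))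
      - Re (\<Sum>s\<in>X. \<Sum>t\<in>X. \<rho>X s t * from_spectrum X h (\<lambda>k. ln (w k)) t s)
    \<le> (\<Sum>i\<in>X\<times>Y. p i * ln (p i))
      - Re (\<Sum>s\<in>X\<times>Y. \<Sum>t\<in>X\<times>Y. \<rho> s t * from_spectrum (X \<times> Y) f (\<lambda>k. ln (q k)) t s)"
proof -
  let ?T = "X \<times> Y"
  have finT: "finite ?T" using fin by simp
  note onb = \<rho>[unfolded pos_spectral_def, THEN conjunct1] \<sigma>[unfolded pos_spectral_def, THEN conjunct1]
    \<rho>X[unfolded pos_spectral_def, THEN conjunct1] \<sigma>X[unfolded pos_spectral_def, THEN conjunct1]
  have pos: "\<And>i. i \<in> ?T \<Longrightarrow> 0 < p i" "\<And>i. i \<in> ?T \<Longrightarrow> 0 < q i"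
    "\<And>i. i \<in> X \<Longrightarrow> 0 < r i" "\<And>i. i \<in> X \<Longrightarrow> 0 < w i"
    using \<rho> \<sigma> \<rho>X \<sigma>X by (auto simp: pos_spectral_def)
  have eq\<rho>: "\<And>s t. s \<in> ?T \<Longrightarrow> t \<in> ?T \<Longrightarrow> \<rho> s t = from_spectrum ?T e p s t"
    using \<rho> unfolding pos_spectral_def by blast
  have eq\<sigma>: "\<And>s t. s \<in> ?T \<Longrightarrow> t \<in> ?T \<Longrightarrow> \<sigma> s t = from_spectrum ?T f q s t"
    using \<sigma> unfolding pos_spectral_def by blast
  have eq\<rho>X: "\<And>s t. s \<in> X \<Longrightarrow> t \<in> X \<Longrightarrow> \<rho>X s t = from_spectrum X g r s t"
    using \<rho>X unfolding pos_spectral_def by blast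
  have eq\<sigma>X: "\<And>s t. s \<in> X \<Longrightarrow> t \<in> X \<Longrightarrow> \<sigma>X s t = from_spectrum X h w s t"
    using \<sigma>X unfolding pos_spectral_def by blast
  have "(\<Sum>x\<in>X. \<rho>X x x) = (\<Sum>s\<in>?T. \<rho> s s)"
    by (simp add: trace_\<rho> sum.cartesian_product')
  then have trace: "(\<Sum>i\<in>X. r i) = (\<Sum>i\<in>?T. p i)"
    using trace_from_spectrum_self[OF onb(1), of p] trace_from_spectrum_self[OF onb(3), of r]
    by (simp add: eq\<rho> eq\<rho>X del: of_real_sum)
  define D where "D = (\<lambda>s. log_interpolation ?T e p f q s - log_interpolation X g r h w s)"
  have "D 0 \<le> D 1"
  \<comment> \<open>The derivative formula divides by \<open>1 - s\<close> and serves on the open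
    interval; continuity covers the endpoints, where the relative entropies are read off.\<close>
  proof (rule DERIV_nonneg_imp_increasing_open[where f = D])
    show "continuous_on {0..1} D"
      unfolding D_def using pos by (intro continuous_intros continuous_on_log_interpolation) auto
    fix s :: real assume s: "0 < s" "s < 1"
    have kT: "(1 - s) * q j + s * p i > 0" if "i \<in> ?T" "j \<in> ?T" for i j
      using convex_pos[of "q j" "p i" s] pos that s by simp
    have kX: "(1 - s) * w j + s * r i > 0" if "i \<in> X" "j \<in> X" for i j
      using convex_pos[of "w j" "r i" s] pos that s by simp
    obtain N where "variational X (from_spectrum X g r) (from_spectrum X h w) (1 - s) s N
        = inverse_form X g r h w (1 - s) s"
      using variational_attained[OF fin(1) onb(3,4), of "1 - s" w s r] kX by blast
    then have "inverse_form X g r h w (1 - s) s = variational X \<rho>X \<sigma>X (1 - s) s N"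
      using variational_cong[of X \<rho>X _ \<sigma>X] eq\<rho>X eq\<sigma>X by metis
    also have "\<dots> = variational ?T \<rho> \<sigma> (1 - s) s (\<lambda>(x, y) (x', y'). if y = y' then N x x' else 0)"
      by (rule variational_tensor[of X Y \<rho>X \<rho> \<sigma>X \<sigma>, OF fin trace_\<rho> trace_\<sigma>, symmetric])
    also have "\<dots> = variational ?T (from_spectrum ?T e p) (from_spectrum ?T f q) (1 - s) s
        (\<lambda>(x, y) (x', y'). if y = y' then N x x' else 0)"
      by (rule variational_cong[OF eq\<rho> eq\<sigma>])
    also have "\<dots> \<le> inverse_form ?T e p f q (1 - s) s"
      by (rule variational_le[OF finT onb(1,2) kT])
    finally have le: "inverse_form X g r h w (1 - s) s \<le> inverse_form ?T e p f q (1 - s) s" .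
    have "(D has_real_derivative
        (inverse_form ?T e p f q (1 - s) s - (\<Sum>i\<in>?T. p i)) / (1 - s)
        - (inverse_form X g r h w (1 - s) s - (\<Sum>i\<in>X. r i)) / (1 - s)) (at s)"
      unfolding D_def using finT fin pos onb s by (intro DERIV_diff DERIV_log_interpolation) auto
    moreover have "0 \<le> (inverse_form ?T e p f q (1 - s) s - (\<Sum>i\<in>?T. p i)) / (1 - s)
        - (inverse_form X g r h w (1 - s) s - (\<Sum>i\<in>X. r i)) / (1 - s)"
      using le s trace by (simp add: diff_divide_distrib[symmetric])
    ultimately show "\<exists>y. (D has_real_derivative y) (at s) \<and> 0 \<le> y" by blast
  qed simp
  moreover have "Re (\<Sum>s\<in>X. \<Sum>t\<in>X. \<rho>X s t * from_spectrum X h (\<lambda>k. ln (w k)) t s)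
      = log_interpolation X g r h w 0"
    unfolding log_interpolation_0 using eq\<rho>X by simp
  moreover have "Re (\<Sum>s\<in>?T. \<Sum>t\<in>?T. \<rho> s t * from_spectrum ?T f (\<lambda>k. ln (q k)) t s)
      = log_interpolation ?T e p f q 0"
    unfolding log_interpolation_0 using eq\<rho> by (intro arg_cong[where f = Re] sum.cong refl) auto
  ultimately show ?thesis
    using log_interpolation_1[OF finT onb(1,2)] log_interpolation_1[OF fin(1) onb(3,4)]
    by (simp add: D_def)
qed

section \<open>Tensoring with the identity and relabelling bases\<close>

text \<open>The operator \<open>1 \<otimes> M\<close>.\<close>

definition op_extend :: "'j op \<Rightarrow> ('i \<times> 'j) op" where
  "op_extend M = (\<lambda>(x, y) (x', y'). if x = x' then M y y' else 0)"

text \<open>Read as a family of vectors, \<open>op_extend f\<close> consists of the products of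
  coordinate vectors with the \<open>f y\<close>. Applied to the values \<open>ln (q y)\<close>,
  this says log(1 tensor M) = 1 tensor log M.\<close>

lemma from_spectrum_op_extend:
  assumes "finite X" "s \<in> X \<times> Y" "t \<in> X \<times> Y"
  shows "from_spectrum (X \<times> Y) (op_extend f) (\<lambda>(x, y). q y) s t = op_extend (from_spectrum Y f q) s t"
proof -
  obtain x y x' y' where st: "s = (x, y)" "t = (x', y')" by fastforce
  have "from_spectrum (X \<times> Y) (op_extend f) (\<lambda>(x, y). q y) s t
      = (\<Sum>a\<in>X. \<Sum>b\<in>Y. if a = x then if x = x' then of_real (q b) * f b y * cnj (f b y') else 0 else 0)"
    unfolding from_spectrum_def st sum.cartesian_product'
    by (intro sum.cong refl) (auto simp: op_extend_def)
  also have "\<dots> = (if x = x' then \<Sum>b\<in>Y. of_real (q b) * f b y * cnj (f b y') else 0)"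
    using assms by (simp add: sum_if_const st)
  finally show ?thesis by (simp add: op_extend_def st from_spectrum_def)
qed

lemma orthonormal_basis_op_extend:
  assumes "finite X" "orthonormal_basis Y f"
  shows "orthonormal_basis (X \<times> Y) (op_extend f)"
  unfolding orthonormal_basis_def
proof (intro ballI)
  fix j k assume jk: "j \<in> X \<times> Y" "k \<in> X \<times> Y"
  obtain a b a' b' where ab: "j = (a, b)" "k = (a', b')" by fastforce
  have "(\<Sum>s\<in>X\<times>Y. cnj (op_extend f j s) * op_extend f k s)
      = (\<Sum>x\<in>X. \<Sum>y\<in>Y. if x = a then if a = a' then cnj (f b y) * f b' y else 0 else 0)"
    unfolding ab sum.cartesian_product' by (intro sum.cong refl) (auto simp: op_extend_def)
  also have "\<dots> = (if a = a' then \<Sum>y\<in>Y. cnj (f b y) * f b' y else 0)"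
    using assms jk by (simp add: sum_if_const ab)
  finally show "(\<Sum>s\<in>X\<times>Y. cnj (op_extend f j s) * op_extend f k s) = (if j = k then 1 else 0)"
    using assms jk by (auto simp: orthonormal_basis_def ab)
qed

text \<open>Families are indexed by the coordinate set itself, so a relabelling acts on the index of
  a vector and on its coordinates at once.\<close>

lemma orthonormal_basis_reindex:
  assumes "bij_betw \<phi> X X'" "orthonormal_basis X' e"
  shows "orthonormal_basis X (\<lambda>j x. e (\<phi> j) (\<phi> x))"
  unfolding orthonormal_basis_def
proof (intro ballI)
  fix j k assume "j \<in> X" "k \<in> X"
  moreover have "(\<Sum>x\<in>X. cnj (e (\<phi> j) (\<phi> x)) * e (\<phi> k) (\<phi> x)) = (\<Sum>x\<in>X'. cnj (e (\<phi> j) x) * e (\<phi> k) x)"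
    by (rule sum.reindex_bij_betw[OF assms(1)])
  ultimately show "(\<Sum>x\<in>X. cnj (e (\<phi> j) (\<phi> x)) * e (\<phi> k) (\<phi> x)) = (if j = k then 1 else 0)"
    using assms by (auto simp: orthonormal_basis_def bij_betw_def inj_on_def)
qed

lemma from_spectrum_reindex:
  assumes "bij_betw \<phi> X X'"
  shows "from_spectrum X (\<lambda>j x. e (\<phi> j) (\<phi> x)) (\<lambda>k. l (\<phi> k)) x y = from_spectrum X' e l (\<phi> x) (\<phi> y)"
  unfolding from_spectrum_def
  by (rule sum.reindex_bij_betw[OF assms, where g = "\<lambda>k. of_real (l k) * e k (\<phi> x) * cnj (e k (\<phi> y))"])

lemma pos_spectral_reindex:
  assumes "bij_betw \<phi> X X'" "pos_spectral X' M e p"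
  shows "pos_spectral X (\<lambda>x y. M (\<phi> x) (\<phi> y)) (\<lambda>j x. e (\<phi> j) (\<phi> x)) (\<lambda>k. p (\<phi> k))"
  using assms bij_betwE[OF assms(1)]
  by (auto simp: pos_spectral_def orthonormal_basis_reindex from_spectrum_reindex)

lemma pos_spectral_op_extend:
  assumes "finite X" "pos_spectral Y M f q"
  shows "pos_spectral (X \<times> Y) (op_extend M) (op_extend f) (\<lambda>(x, y). q y)"
  using assms unfolding pos_spectral_def
  by (auto simp: orthonormal_basis_op_extend from_spectrum_op_extend) (auto simp: op_extend_def)

text \<open>Tr(R (1 tensor L)) depends on \<open>R\<close> only through its partial trace over
  \<open>X\<close>; this turns Tr(rho log sigma) into the entropy of a marginal.\<close>

lemma trace_op_extend:
  assumes "finite X"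
  shows "(\<Sum>s\<in>X\<times>Y. \<Sum>t\<in>X\<times>Y. R s t * op_extend L t s)
    = (\<Sum>y\<in>Y. \<Sum>y'\<in>Y. (\<Sum>x\<in>X. R (x, y) (x, y')) * L y' y)"
proof -
  have "(\<Sum>s\<in>X\<times>Y. \<Sum>t\<in>X\<times>Y. R s t * op_extend L t s)
      = (\<Sum>x\<in>X. \<Sum>y\<in>Y. \<Sum>x'\<in>X. \<Sum>y'\<in>Y. if x' = x then R (x, y) (x, y') * L y' y else 0)"
    unfolding sum.cartesian_product' by (intro sum.cong refl) (auto simp: op_extend_def)
  also have "\<dots> = (\<Sum>x\<in>X. \<Sum>y\<in>Y. \<Sum>y'\<in>Y. R (x, y) (x, y') * L y' y)"
    using assms by (simp add: sum_if_const cong: sum.cong)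
  also have "\<dots> = (\<Sum>y\<in>Y. \<Sum>y'\<in>Y. \<Sum>x\<in>X. R (x, y) (x, y') * L y' y)"
    by (rule sum_rotate3[symmetric])
  finally show ?thesis by (simp add: sum_distrib_right)
qed

section \<open>Strong subadditivity\<close>

text \<open>Monotonicity under tracing out \<open>Y\<close>, with 1 tensor rho_ZY as second operator
  and 1 tensor rho_Z as its partial trace. The terms Tr(rho log sigma) become the negative entropies
  of \<open>ZY\<close> and \<open>Z\<close>.\<close>

lemma strong_subadditivity_spectral:
  assumes fin: "finite X" "finite Y" "finite Z"
    and XZY: "pos_spectral ((X \<times> Z) \<times> Y) R e p"
    and ZY: "pos_spectral (Z \<times> Y) RZY f q"
    and XZ: "pos_spectral (X \<times> Z) RXZ g r"
    and Z: "pos_spectral Z RZ h w"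
    and trX: "\<And>z y z' y'. \<lbrakk>z \<in> Z; y \<in> Y; z' \<in> Z; y' \<in> Y\<rbrakk> \<Longrightarrow> RZY (z, y) (z', y') = (\<Sum>x\<in>X. R ((x, z), y) ((x, z'), y'))"
    and trY: "\<And>s t. \<lbrakk>s \<in> X \<times> Z; t \<in> X \<times> Z\<rbrakk> \<Longrightarrow> RXZ s t = (\<Sum>y\<in>Y. R (s, y) (t, y))"
    and trZY: "\<And>z z'. \<lbrakk>z \<in> Z; z' \<in> Z\<rbrakk> \<Longrightarrow> RZ z z' = (\<Sum>y\<in>Y. RZY (z, y) (z', y))"
  shows "(\<Sum>i\<in>X \<times> Z. r i * ln (r i)) + (\<Sum>i\<in>Z \<times> Y. q i * ln (q i))
    \<le> (\<Sum>i\<in>(X \<times> Z) \<times> Y. p i * ln (p i)) + (\<Sum>i\<in>Z. w i * ln (w i))"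
proof -
  \<comment> \<open>\<open>op_extend\<close> splits off \<open>X\<close> in front, the partial trace
    splits off \<open>Y\<close> at the end; \<open>\<phi>\<close> and \<open>\<psi>\<close>
    translate between the two bracketings.\<close>
  define \<phi> :: "('a \<times> 'c) \<times> 'b \<Rightarrow> 'a \<times> 'c \<times> 'b" where "\<phi> = (\<lambda>((x, z), y). (x, z, y))"
  define \<psi> :: "'a \<times> 'c \<times> 'b \<Rightarrow> ('a \<times> 'c) \<times> 'b" where "\<psi> = (\<lambda>(x, z, y). ((x, z), y))"
  let ?T = "(X \<times> Z) \<times> Y"
  let ?q = "\<lambda>k. case \<phi> k of (x, y) \<Rightarrow> q y" and ?w = "\<lambda>(x, z). w z"
  let ?f = "\<lambda>j s. op_extend f (\<phi> j) (\<phi> s)"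
  have \<phi>: "bij_betw \<phi> ?T (X \<times> Z \<times> Y)" and \<psi>: "bij_betw \<psi> (X \<times> Z \<times> Y) ?T"
    by (auto simp: bij_betw_def inj_on_def \<phi>_def \<psi>_def image_iff)
  have \<phi>\<psi>: "\<phi> (\<psi> s) = s" for s by (simp add: \<phi>_def \<psi>_def split: prod.split)
  have \<sigma>: "pos_spectral ?T (\<lambda>s t. op_extend RZY (\<phi> s) (\<phi> t)) ?f ?q"
    by (rule pos_spectral_reindex[OF \<phi> pos_spectral_op_extend[OF fin(1) ZY]])
  have \<sigma>X: "pos_spectral (X \<times> Z) (op_extend RZ) (op_extend h) ?w"
    by (rule pos_spectral_op_extend[OF fin(1) Z])
  have tr\<sigma>: "op_extend RZ s t = (\<Sum>y\<in>Y. op_extend RZY (\<phi> (s, y)) (\<phi> (t, y)))"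
    if "s \<in> X \<times> Z" "t \<in> X \<times> Z" for s t
    using that trZY by (auto simp: op_extend_def \<phi>_def)
  have spec: "finite (X \<times> Z)" "orthonormal_basis (Z \<times> Y) f" "orthonormal_basis Z h"
    "\<And>s t. s \<in> Z \<times> Y \<Longrightarrow> t \<in> Z \<times> Y \<Longrightarrow> RZY s t = from_spectrum (Z \<times> Y) f q s t"
    "\<And>s t. s \<in> Z \<Longrightarrow> t \<in> Z \<Longrightarrow> RZ s t = from_spectrum Z h w s t"
    using fin ZY Z unfolding pos_spectral_def by auto
  have "(\<Sum>s\<in>X\<times>Z. \<Sum>t\<in>X\<times>Z. RXZ s t * from_spectrum (X \<times> Z) (op_extend h) (\<lambda>k. ln (?w k)) t s)
      = (\<Sum>s\<in>X\<times>Z. \<Sum>t\<in>X\<times>Z. RXZ s t * op_extend (from_spectrum Z h (\<lambda>k. ln (w k))) t s)"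
    using from_spectrum_op_extend[OF fin(1), where q = "\<lambda>k. ln (w k)"]
    by (intro sum.cong refl) (simp add: case_prod_unfold)
  also have "\<dots> = (\<Sum>z\<in>Z. \<Sum>z'\<in>Z. RZ z z' * from_spectrum Z h (\<lambda>k. ln (w k)) z' z)"
  proof -
    have "(\<Sum>x\<in>X. RXZ (x, z) (x, z')) = RZ z z'" if "z \<in> Z" "z' \<in> Z" for z z'
    proof -
      have "(\<Sum>x\<in>X. RXZ (x, z) (x, z')) = (\<Sum>x\<in>X. \<Sum>y\<in>Y. R ((x, z), y) ((x, z'), y))"
        using that by (intro sum.cong refl) (simp add: trY)
      also have "\<dots> = RZ z z'"
        using that by (subst sum.swap) (simp add: trX trZY)
      finally show ?thesis .
    qed
    then show ?thesis unfolding trace_op_extend[OF fin(1)] by simp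
  qed
  also have "\<dots> = of_real (\<Sum>i\<in>Z. w i * ln (w i))"
    using trace_from_spectrum_same[OF fin(3) spec(3)] by (simp add: spec(5))
  finally have logX: "Re (\<Sum>s\<in>X\<times>Z. \<Sum>t\<in>X\<times>Z. RXZ s t * from_spectrum (X \<times> Z) (op_extend h) (\<lambda>k. ln (?w k)) t s)
      = (\<Sum>i\<in>Z. w i * ln (w i))" by (simp only: Re_complex_of_real)
  let ?L = "from_spectrum (Z \<times> Y) f (\<lambda>k. ln (q k))"
  have "(\<Sum>s\<in>?T. \<Sum>t\<in>?T. R s t * from_spectrum ?T ?f (\<lambda>k. ln (?q k)) t s)
      = (\<Sum>s\<in>?T. \<Sum>t\<in>?T. R s t * op_extend ?L (\<phi> t) (\<phi> s))"
  proof (intro sum.cong refl arg_cong2[where f = "(*)"])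
    fix s t assume "s \<in> ?T" "t \<in> ?T"
    then have "\<phi> s \<in> X \<times> Z \<times> Y" "\<phi> t \<in> X \<times> Z \<times> Y" using bij_betwE[OF \<phi>] by auto
    then show "from_spectrum ?T ?f (\<lambda>k. ln (?q k)) t s = op_extend ?L (\<phi> t) (\<phi> s)"
      using from_spectrum_reindex[OF \<phi>, of "op_extend f" "\<lambda>(x, y). ln (q y)"]
        from_spectrum_op_extend[OF fin(1), where q = "\<lambda>k. ln (q k)"]
      by (simp add: case_prod_unfold)
  qed
  also have "\<dots> = (\<Sum>s\<in>X \<times> Z \<times> Y. \<Sum>t\<in>X \<times> Z \<times> Y. R (\<psi> s) (\<psi> t) * op_extend ?L t s)"
    by (simp add: sum.reindex_bij_betw[OF \<psi>, symmetric] \<phi>\<psi>)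
  also have "\<dots> = (\<Sum>s\<in>Z \<times> Y. \<Sum>t\<in>Z \<times> Y. RZY s t * ?L t s)"
    unfolding trace_op_extend[OF fin(1)]
    by (intro sum.cong refl) (auto simp: trX \<psi>_def)
  also have "\<dots> = of_real (\<Sum>i\<in>Z \<times> Y. q i * ln (q i))"
    using trace_from_spectrum_same[OF _ spec(2)] fin by (simp add: spec(4))
  finally have logT: "Re (\<Sum>s\<in>?T. \<Sum>t\<in>?T. R s t * from_spectrum ?T ?f (\<lambda>k. ln (?q k)) t s)
      = (\<Sum>i\<in>Z \<times> Y. q i * ln (q i))" by (simp only: Re_complex_of_real)
  from relative_entropy_partial_trace_le[OF spec(1) fin(2) XZY \<sigma> XZ \<sigma>X trY tr\<sigma>]
  show ?thesis unfolding logX logT by simp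
qed

lemma op_app_eigenvector:
  assumes "finite X" "orthonormal_basis X e" "k \<in> X" "x \<in> X"
    and M: "\<And>x y. x \<in> X \<Longrightarrow> y \<in> X \<Longrightarrow> M x y = from_spectrum X e l x y"
  shows "op_app X M (e k) x = of_real (l k) * e k x"
proof -
  have "op_app X M (e k) x = (\<Sum>y\<in>X. \<Sum>j\<in>X. of_real (l j) * e j x * (cnj (e j y) * e k y))"
    using assms by (simp add: op_app_def from_spectrum_def sum_distrib_right mult.assoc)
  also have "\<dots> = (\<Sum>j\<in>X. of_real (l j) * e j x * cinner X (e j) (e k))"
    by (subst sum.swap) (simp add: cinner_def sum_distrib_left)
  also have "\<dots> = (\<Sum>j\<in>X. if j = k then of_real (l j) * e j x else 0)"
    using assms(2,3) by (intro sum.cong refl) (auto simp: orthonormal_basis_iff_cinner)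
  finally show ?thesis using assms by simp
qed

text \<open>The quadratic form at the unit eigenvector \<open>e k\<close> equals
  \<open>l k\<close>.\<close>

lemma positive_definite_pos_spectral:
  assumes "finite X" "positive_definite X M" "orthonormal_basis X e"
    and M: "\<And>x y. x \<in> X \<Longrightarrow> y \<in> X \<Longrightarrow> M x y = from_spectrum X e l x y"
  shows "pos_spectral X M e l"
  unfolding pos_spectral_def
proof (intro conjI ballI assms(3) M)
  fix k assume k: "k \<in> X"
  have e1: "cinner X (e k) (e k) = 1" using assms(3) k by (simp add: orthonormal_basis_iff_cinner)
  then have "\<exists>x\<in>X. e k x \<noteq> 0" using cinner_self_eq_0_iff[OF assms(1), of "e k"] by auto
  then have "Re (\<Sum>x\<in>X. \<Sum>y\<in>X. cnj (e k x) * M x y * e k y) > 0"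
    using assms(2) by (simp add: positive_definite_def)
  also have "(\<Sum>x\<in>X. \<Sum>y\<in>X. cnj (e k x) * M x y * e k y) = cinner X (e k) (op_app X M (e k))"
    by (simp add: cinner_def op_app_def sum_distrib_left mult.assoc)
  also have "\<dots> = cinner X (e k) (\<lambda>x. of_real (l k) * e k x)"
    using op_app_eigenvector[OF assms(1,3) k _ M] by (intro cinner_cong) auto
  also have "\<dots> = of_real (l k)" using e1 by (simp add: cinner_mult_right)
  finally show "0 < l k" by simp
qed

text \<open>The choice in \<open>op_log\<close> always comes from some eigenbasis. That very basis
  is handed out, so logarithms from different eigenbases never have to be compared.\<close>

lemma entropy_spectral:
  assumes fin: "finite X" and pd: "positive_definite X M"
  obtains e l where "pos_spectral X M e l"
    "Re (op_trace X (op_mult X M (op_log X M))) = (\<Sum>k\<in>X. l k * ln (l k))"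
proof -
  have "self_adjoint X M" using pd by (simp add: positive_definite_def)
  from spectral_decomposition[OF fin this]
  have "\<exists>L e l. orthonormal_basis X e \<and> (\<forall>x\<in>X. \<forall>y\<in>X. M x y = from_spectrum X e l x y) \<and>
      L = from_spectrum X e (\<lambda>k. ln (l k))" by metis
  from someI_ex[OF this] obtain e l where el: "orthonormal_basis X e"
    "\<And>x y. x \<in> X \<Longrightarrow> y \<in> X \<Longrightarrow> M x y = from_spectrum X e l x y"
    and log: "op_log X M = from_spectrum X e (\<lambda>k. ln (l k))"
    unfolding op_log_def by blast
  have "op_trace X (op_mult X M (op_log X M)) = of_real (\<Sum>k\<in>X. l k * ln (l k))"
    unfolding op_trace_def op_mult_def log trace_from_spectrum_same[OF fin el(1), symmetric]
    using el(2) by (intro sum.cong refl) simp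
  then have "Re (op_trace X (op_mult X M (op_log X M))) = (\<Sum>k\<in>X. l k * ln (l k))"
    by (simp only: Re_complex_of_real)
  with positive_definite_pos_spectral[OF fin pd el] that show ?thesis by blast
qed

section \<open>Product bases and marginals\<close>

lemma finite_basis_index: "finite A \<Longrightarrow> finite (basis_index d A)"
  unfolding basis_index_def by (intro finite_PiE) auto

text \<open>The coordinate form of the identification of the space of \<open>A \<union> B\<close>
  with the tensor product of those of \<open>A\<close> and \<open>B\<close>.\<close>

lemma bij_betw_merge_basis_index:
  assumes "A \<inter> B = {}"
  shows "bij_betw (merge A B) (basis_index d A \<times> basis_index d B) (basis_index d (A \<union> B))"
proof (rule bij_betw_byWitness[where f' = "\<lambda>s. (restrict s A, restrict s B)"])
  show "\<forall>s\<in>basis_index d A \<times> basis_index d B. (restrict (merge A B s) A, restrict (merge A B s) B) = s"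
    using assms by (auto simp: basis_index_def merge_def restrict_def PiE_def extensional_def fun_eq_iff)
  show "\<forall>s\<in>basis_index d (A \<union> B). merge A B (restrict s A, restrict s B) = s"
    by (auto simp: basis_index_def merge_def restrict_def PiE_def extensional_def fun_eq_iff)
  show "merge A B ` (basis_index d A \<times> basis_index d B) \<subseteq> basis_index d (A \<union> B)"
    using assms by (fastforce simp: basis_index_def merge_def PiE_def extensional_def Pi_def)
  show "(\<lambda>s. (restrict s A, restrict s B)) ` basis_index d (A \<union> B) \<subseteq> basis_index d A \<times> basis_index d B"
    by (auto simp: basis_index_def)
qed

lemma merge_mem_basis_index:
  assumes "A \<inter> B = {}" "x \<in> basis_index d A" "y \<in> basis_index d B"
  shows "merge A B (x, y) \<in> basis_index d (A \<union> B)"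
  using bij_betwE[OF bij_betw_merge_basis_index[OF assms(1)]] assms(2,3) by blast

lemma sum_basis_index_Un:
  assumes "A \<inter> B = {}"
  shows "(\<Sum>s\<in>basis_index d (A \<union> B). F s) = (\<Sum>x\<in>basis_index d A. \<Sum>y\<in>basis_index d B. F (merge A B (x, y)))"
  unfolding sum.reindex_bij_betw[OF bij_betw_merge_basis_index[OF assms], symmetric]
  by (rule sum.cartesian_product')

text \<open>Tracing out in stages: the complement of \<open>A\<close> is \<open>B\<close> together
  with the complement of \<open>A \<union> B\<close>.\<close>

lemma marginal_Un:
  assumes "A \<inter> B = {}" "A \<union> B \<subseteq> V"
  shows "marginal d V \<rho> A x y
    = (\<Sum>z\<in>basis_index d B. marginal d V \<rho> (A \<union> B) (merge A B (x, z)) (merge A B (y, z)))"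
proof -
  have V: "V - A = B \<union> (V - (A \<union> B))" "B \<inter> (V - (A \<union> B)) = {}" using assms by auto
  have m: "merge A (B \<union> (V - (A \<union> B))) (x, merge B (V - (A \<union> B)) (z, t))
      = merge (A \<union> B) (V - (A \<union> B)) (merge A B (x, z), t)" for x z t
    by (auto simp: merge_def fun_eq_iff)
  show ?thesis
    unfolding marginal_def V(1) sum_basis_index_Un[OF V(2)] m ..
qed

text \<open>The form of the marginal at \<open>u\<close> is the sum over \<open>z\<close> of the
  form of \<open>\<rho>\<close> at \<open>u\<close> tensor the basis vector of
  \<open>z\<close>.\<close>

lemma positive_definite_marginal:
  assumes "finite V" "density_pd d V \<rho>" "A \<subseteq> V"
  shows "positive_definite (basis_index d A) (marginal d V \<rho> A)"
proof -
  let ?B = "V - A"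
  have AB: "A \<inter> ?B = {}" "A \<union> ?B = V" using assms(3) by auto
  have pd: "positive_definite (basis_index d V) \<rho>" and tr: "op_trace (basis_index d V) \<rho> = 1"
    using assms(2) by (auto simp: density_pd_def)
  have mem: "merge A ?B (x, z) \<in> basis_index d V" if "x \<in> basis_index d A" "z \<in> basis_index d ?B" for x z
    using merge_mem_basis_index[OF AB(1) that] AB(2) by simp
  have fin: "finite (basis_index d A)" "finite (basis_index d ?B)"
    using assms finite_subset by (auto intro!: finite_basis_index)
  \<comment> \<open>Trace one excludes the zero space, so at least one \<open>z\<close> exists and
    the sum of positive terms is strictly positive.\<close>
  have "basis_index d V \<noteq> {}" using tr by (auto simp: op_trace_def)
  then have ne: "basis_index d ?B \<noteq> {}"
    using bij_betw_merge_basis_index[OF AB(1), of d] AB(2) by (auto simp: bij_betw_def)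
  have "self_adjoint (basis_index d A) (marginal d V \<rho> A)"
    unfolding self_adjoint_def marginal_def cnj_sum
  proof (intro ballI sum.cong refl)
    fix x y z assume "x \<in> basis_index d A" "y \<in> basis_index d A" "z \<in> basis_index d ?B"
    then show "\<rho> (merge A ?B (x, z)) (merge A ?B (y, z)) = cnj (\<rho> (merge A ?B (y, z)) (merge A ?B (x, z)))"
      using pd mem unfolding positive_definite_def self_adjoint_def by blast
  qed
  moreover have "Re (\<Sum>x\<in>basis_index d A. \<Sum>y\<in>basis_index d A. cnj (u x) * marginal d V \<rho> A x y * u y) > 0"
    if u: "\<exists>x\<in>basis_index d A. u x \<noteq> 0" for u
  proof -
    define Q where "Q = (\<lambda>z. \<Sum>x\<in>basis_index d A. \<Sum>y\<in>basis_index d A.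
      cnj (u x) * \<rho> (merge A ?B (x, z)) (merge A ?B (y, z)) * u y)"
    have Q: "(\<Sum>x\<in>basis_index d A. \<Sum>y\<in>basis_index d A. cnj (u x) * marginal d V \<rho> A x y * u y)
      = (\<Sum>z\<in>basis_index d ?B. Q z)"
      unfolding Q_def marginal_def sum_distrib_left sum_distrib_right by (rule sum_rotate3)
    have "Re (Q z) > 0" if z: "z \<in> basis_index d ?B" for z
    proof -
      define v where "v = (\<lambda>s. if restrict s ?B = z then u (restrict s A) else 0)"
      have v: "v (merge A ?B (x, t)) = (if t = z then u x else 0)"
        if "x \<in> basis_index d A" "t \<in> basis_index d ?B" for x t
        using that AB by (simp add: v_def basis_index_def PiE_restrict)
      have "(\<Sum>s\<in>basis_index d V. \<Sum>s'\<in>basis_index d V. cnj (v s) * \<rho> s s' * v s')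
        = (\<Sum>x\<in>basis_index d A. \<Sum>t\<in>basis_index d ?B. \<Sum>y\<in>basis_index d A. \<Sum>t'\<in>basis_index d ?B.
             if t' = z then if t = z then cnj (u x) * \<rho> (merge A ?B (x, t)) (merge A ?B (y, t')) * u y else 0 else 0)"
        unfolding sum_basis_index_Un[OF AB(1), unfolded AB(2)]
        by (intro sum.cong refl) (simp add: v)
      also have "\<dots> = Q z"
        using fin z by (simp add: sum_if_const Q_def)
      finally have eq: "(\<Sum>s\<in>basis_index d V. \<Sum>s'\<in>basis_index d V. cnj (v s) * \<rho> s s' * v s') = \<dots>" .
      have "\<exists>s\<in>basis_index d V. v s \<noteq> 0" using u v mem z by metis
      then have "Re (\<Sum>s\<in>basis_index d V. \<Sum>s'\<in>basis_index d V. cnj (v s) * \<rho> s s' * v s') > 0"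
        using pd unfolding positive_definite_def by blast
      then show ?thesis unfolding eq .
    qed
    then have "0 < (\<Sum>z\<in>basis_index d ?B. Re (Q z))" by (rule sum_pos[OF fin(2) ne])
    then show ?thesis unfolding Q Re_sum[of Q] .
  qed
  ultimately show ?thesis unfolding positive_definite_def by blast
qed

text \<open>The spectral inequality has the shared factor in the middle, so the sets are taken in
  the order \<open>A\<close>, \<open>C\<close>, \<open>B\<close>; \<open>merge\<close> carries the
  eigenbases of the marginals over to product index sets. Entropies are the negated sums, which
  turns the inequality around.\<close>

theorem strong_subadditivity:
  fixes V :: "'v set"
  assumes V: "finite V" and \<rho>: "density_pd d V \<rho>" and ABC: "A \<union> B \<union> C \<subseteq> V"
    and disj: "A \<inter> B = {}" "A \<inter> C = {}" "B \<inter> C = {}"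
  shows "vn_entropy d V \<rho> C + vn_entropy d V \<rho> (A \<union> B \<union> C) \<le> vn_entropy d V \<rho> (A \<union> C) + vn_entropy d V \<rho> (B \<union> C)"
proof -
  let ?X = "basis_index d A" and ?Y = "basis_index d B" and ?Z = "basis_index d C"
  let ?R = "marginal d V \<rho>"
  have fin: "finite A" "finite B" "finite C"
    using V ABC finite_subset by auto
  have entropy: "\<exists>e l. pos_spectral (basis_index d W) (?R W) e l \<and>
      vn_entropy d V \<rho> W = - (\<Sum>k\<in>basis_index d W. l k * ln (l k))" if "W \<subseteq> V" for W
  proof -
    have "finite (basis_index d W)" using V that finite_subset finite_basis_index by metis
    from entropy_spectral[OF this positive_definite_marginal[OF V \<rho> that]] show ?thesis
      unfolding vn_entropy_def Let_def by metis
  qed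
  define \<phi> :: "(('v \<Rightarrow> nat) \<times> ('v \<Rightarrow> nat)) \<times> ('v \<Rightarrow> nat) \<Rightarrow> 'v \<Rightarrow> nat"
    where "\<phi> = (\<lambda>(s, y). merge (A \<union> C) B (merge A C s, y))"
  have \<phi>: "bij_betw \<phi> ((?X \<times> ?Z) \<times> ?Y) (basis_index d (A \<union> C \<union> B))"
  proof -
    have "bij_betw (map_prod (merge A C) id) ((?X \<times> ?Z) \<times> ?Y) (basis_index d (A \<union> C) \<times> ?Y)"
      using bij_betw_merge_basis_index[OF disj(2)] by (intro bij_betw_map_prod) auto
    moreover have "bij_betw (merge (A \<union> C) B) (basis_index d (A \<union> C) \<times> ?Y) (basis_index d (A \<union> C \<union> B))"
      using disj by (intro bij_betw_merge_basis_index) auto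
    ultimately have "bij_betw (merge (A \<union> C) B \<circ> map_prod (merge A C) id) ((?X \<times> ?Z) \<times> ?Y) (basis_index d (A \<union> C \<union> B))"
      by (rule bij_betw_trans)
    moreover have "merge (A \<union> C) B \<circ> map_prod (merge A C) id = \<phi>"
      by (auto simp: \<phi>_def fun_eq_iff)
    ultimately show ?thesis by simp
  qed
  have XZ: "bij_betw (merge A C) (?X \<times> ?Z) (basis_index d (A \<union> C))"
    and ZY: "bij_betw (merge C B) (?Z \<times> ?Y) (basis_index d (C \<union> B))"
    using disj by (auto intro!: bij_betw_merge_basis_index)
  obtain e p where ep: "pos_spectral (basis_index d (A \<union> C \<union> B)) (?R (A \<union> C \<union> B)) e p"
    "vn_entropy d V \<rho> (A \<union> C \<union> B) = - (\<Sum>k\<in>basis_index d (A \<union> C \<union> B). p k * ln (p k))"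
    using entropy[of "A \<union> C \<union> B"] ABC by auto
  obtain f q where fq: "pos_spectral (basis_index d (C \<union> B)) (?R (C \<union> B)) f q"
    "vn_entropy d V \<rho> (C \<union> B) = - (\<Sum>k\<in>basis_index d (C \<union> B). q k * ln (q k))"
    using entropy[of "C \<union> B"] ABC by auto
  obtain g r where gr: "pos_spectral (basis_index d (A \<union> C)) (?R (A \<union> C)) g r"
    "vn_entropy d V \<rho> (A \<union> C) = - (\<Sum>k\<in>basis_index d (A \<union> C). r k * ln (r k))"
    using entropy[of "A \<union> C"] ABC by auto
  obtain h w where hw: "pos_spectral ?Z (?R C) h w"
    "vn_entropy d V \<rho> C = - (\<Sum>k\<in>?Z. w k * ln (w k))"
    using entropy[of C] ABC by auto
  have "(\<Sum>k\<in>?X \<times> ?Z. r (merge A C k) * ln (r (merge A C k))) + (\<Sum>k\<in>?Z \<times> ?Y. q (merge C B k) * ln (q (merge C B k)))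
    \<le> (\<Sum>k\<in>(?X \<times> ?Z) \<times> ?Y. p (\<phi> k) * ln (p (\<phi> k))) + (\<Sum>k\<in>?Z. w k * ln (w k))"
  proof (rule strong_subadditivity_spectral[OF _ _ _ pos_spectral_reindex[OF \<phi> ep(1)]
        pos_spectral_reindex[OF ZY fq(1)] pos_spectral_reindex[OF XZ gr(1)] hw(1)])
    show "finite ?X" "finite ?Y" "finite ?Z" using fin by (auto intro: finite_basis_index)
    fix z y z' y'
    have sets: "C \<union> B \<union> A = A \<union> C \<union> B" by auto
    have m: "merge (C \<union> B) A (merge C B (z, y), x) = \<phi> ((x, z), y)" for x z y
      using disj by (auto simp: \<phi>_def merge_def fun_eq_iff)
    show "?R (C \<union> B) (merge C B (z, y)) (merge C B (z', y'))
        = (\<Sum>x\<in>?X. ?R (A \<union> C \<union> B) (\<phi> ((x, z), y)) (\<phi> ((x, z'), y')))"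
      using ABC disj by (subst marginal_Un[where B = A]) (auto simp: sets m)
  next
    fix s t
    show "?R (A \<union> C) (merge A C s) (merge A C t)
        = (\<Sum>y\<in>?Y. ?R (A \<union> C \<union> B) (\<phi> (s, y)) (\<phi> (t, y)))"
      using ABC disj by (subst marginal_Un[where B = B]) (auto simp: \<phi>_def)
  next
    fix z z'
    show "?R C z z' = (\<Sum>y\<in>?Y. ?R (C \<union> B) (merge C B (z, y)) (merge C B (z', y)))"
      using ABC disj by (intro marginal_Un) auto
  qed
  then have "(\<Sum>k\<in>basis_index d (A \<union> C). r k * ln (r k)) + (\<Sum>k\<in>basis_index d (C \<union> B). q k * ln (q k))
    \<le> (\<Sum>k\<in>basis_index d (A \<union> C \<union> B). p k * ln (p k)) + (\<Sum>k\<in>?Z. w k * ln (w k))"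
    using sum.reindex_bij_betw[OF XZ, of "\<lambda>k. r k * ln (r k)"] sum.reindex_bij_betw[OF ZY, of "\<lambda>k. q k * ln (q k)"]
      sum.reindex_bij_betw[OF \<phi>, of "\<lambda>k. p k * ln (p k)"] by simp
  moreover have "A \<union> B \<union> C = A \<union> C \<union> B" "B \<union> C = C \<union> B" by auto
  ultimately show ?thesis using ep fq gr hw by simp
qed

section \<open>Conditional mutual information as a semigraphoid\<close>

lemma cond_mutual_info_nonneg:
  assumes "finite V" "density_pd d V \<rho>" "A \<union> B \<union> C \<subseteq> V" "A \<inter> B = {}" "A \<inter> C = {}" "B \<inter> C = {}"
  shows "0 \<le> cond_mutual_info d V \<rho> A B C"
  using strong_subadditivity[OF assms] by (simp add: cond_mutual_info_def)

text \<open>The entropies of \<open>C \<union> S\<close> and of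
  \<open>A \<union> C \<union> S\<close> cancel, whatever the sets are.\<close>

lemma cond_mutual_info_chain:
  "cond_mutual_info d V \<rho> A (B \<union> C) S = cond_mutual_info d V \<rho> A C S + cond_mutual_info d V \<rho> A B (C \<union> S)"
  by (simp add: cond_mutual_info_def Un_ac)

lemma semigraphoid_q_cond_indep:
  assumes "finite V" "density_pd d V \<rho>"
  shows "semigraphoid V (q_cond_indep d V \<rho>)"
proof
  fix A B C S
  show "q_cond_indep d V \<rho> {} B S"
    by (simp add: q_cond_indep_def cond_mutual_info_def)
  show "q_cond_indep d V \<rho> A B S \<Longrightarrow> q_cond_indep d V \<rho> B A S"
    by (simp add: q_cond_indep_def cond_mutual_info_def Un_ac)
  show "\<lbrakk>q_cond_indep d V \<rho> A C S; q_cond_indep d V \<rho> A B (C \<union> S)\<rbrakk> \<Longrightarrow> q_cond_indep d V \<rho> A (B \<union> C) S"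
    by (simp add: q_cond_indep_def cond_mutual_info_chain)
next
  fix A B C S
  assume *: "A \<union> B \<union> C \<union> S \<subseteq> V" "A \<inter> B = {}" "A \<inter> C = {}" "A \<inter> S = {}" "B \<inter> C = {}"
    "B \<inter> S = {}" "C \<inter> S = {}" "q_cond_indep d V \<rho> A (B \<union> C) S"
  \<comment> \<open>These are the summands of the chain rule for both orders of \<open>B\<close> and
    \<open>C\<close>; nonnegative numbers with sum zero vanish.\<close>
  have nonneg: "0 \<le> cond_mutual_info d V \<rho> A B S" "0 \<le> cond_mutual_info d V \<rho> A C (B \<union> S)"
    "0 \<le> cond_mutual_info d V \<rho> A C S" "0 \<le> cond_mutual_info d V \<rho> A B (C \<union> S)"
    using * by (auto intro!: cond_mutual_info_nonneg[OF assms])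
  show "q_cond_indep d V \<rho> A B S"
    using *(8) nonneg cond_mutual_info_chain[of d V \<rho> A C B S] by (simp add: q_cond_indep_def Un_commute)
  show "q_cond_indep d V \<rho> A B (C \<union> S)"
    using *(8) nonneg cond_mutual_info_chain[of d V \<rho> A B C S] by (simp add: q_cond_indep_def)
qed

theorem theorem3p1:
  fixes V :: "'v set" and E r :: "('v \<times> 'v) set"
    and d :: "'v \<Rightarrow> nat" and \<rho> :: "('v \<Rightarrow> nat) op"
  assumes "finite V"
    and "dag V E"
    and "topological_ordering V E r"
    and "density_pd d V \<rho>"
  shows "(ordered_markov d V E r \<rho> \<longleftrightarrow> local_markov d V E \<rho>)
       \<and> (local_markov d V E \<rho> \<longleftrightarrow> global_markov d V E \<rho>)"
proof -
  interpret semigraphoid V "q_cond_indep d V \<rho>"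
    using assms(1,4) by (rule semigraphoid_q_cond_indep)
  have parents: "parents E v \<subseteq> V" "v \<notin> parents E v" for v
    using assms(2) by (auto simp: dag_def parents_def acyclic_def)
  \<comment> \<open>The cycle from ordered to global to local and back to ordered gives both
    equivalences.\<close>
  have "global_markov d V E \<rho>" if "ordered_markov d V E r \<rho>"
    unfolding global_markov_def
  proof (intro allI impI, elim conjE)
    fix A B S
    assume "A \<subseteq> V" "B \<subseteq> V" "S \<subseteq> V" "A \<inter> B = {}" "A \<inter> S = {}" "B \<inter> S = {}"
      "d_separated V E A B S"
    then show "q_cond_indep d V \<rho> A B S"
      using that unfolding ordered_markov_def by - (rule ordered_imp_global[OF assms(1,3)], auto)
  qed
  moreover have "local_markov d V E \<rho>" if global: "global_markov d V E \<rho>"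
    unfolding local_markov_def
  proof
    fix v assume v: "v \<in> V"
    show "q_cond_indep d V \<rho> {v} (nondescendants V E v - parents E v) (parents E v)"
      using d_separated_nondescendants[OF assms(2) v] parents v
      by - (rule global[unfolded global_markov_def, rule_format], auto simp: nondescendants_def)
  qed
  moreover have "ordered_markov d V E r \<rho>" if local: "local_markov d V E \<rho>"
    unfolding ordered_markov_def
  proof
    fix v assume v: "v \<in> V"
    show "q_cond_indep d V \<rho> {v} (predecessors V r v - parents E v) (parents E v)"
      using predecessors_subset_nondescendants[OF assms(3), of v] parents[of v] v
      by (intro decomposition_subset[OF local[unfolded local_markov_def, rule_format, OF v]])
        (auto simp: nondescendants_def)
  qed
  ultimately show ?thesis by blast
qed

end
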